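(* Consider a dynamical network of $N$ linear time-invariant systems $G_1,\dots,G_N$ interconnected over a directed graph $\Gamma=(\Omega,E)$, with associated undirected graph $\hat\Gamma=(\Omega,\hat E)$, each $G_i$ having the form $$\dot x_i=A_ix_i+\sum_{j\in\mathcal N_i}B_{ij}v_{ij},\qquad w_{ij}=C_{ij}x_i+D_{ij}v_{ij}\quad (j\in\mathcal N_i),$$ as described in the context. Suppose that $\hat\Gamma$ is acyclic and that one of the following two cases holds: 1) the matrices $D_{ij}$ are arbitrary, and each matrix $C_{ij}$ has full row rank; 2) $D_{ij}=0$ for all $(i,j)$ such that $(G_i,G_j)\in E$. Let the overall interconnected network be well-posed. Let $P_i\in\mathbb{R}^{n_i\times n_i}$, $i=1,\dots,N$, be symmetric with $P_i\succ0$, and put $V_i(x_i)=x_i^\top P_ix_i$. Then the following two statements are equivalent: (i) The function $V(x)=V_1(x_1)+\dots+V_N(x_N)$ is an additive quadratic Lyapunov function for the dynamical network. (ii) For each $G_i\in\Omega$ and each $j\in\mathcal N_i$ there exists a quadratic function $s_{ij}(v_{ij},w_{ij})$ such that a) each $G_i$ is strictly dissipative with respect to the supply function $\sum_{j\in\mathcal N_i}s_{ij}(v_{ij},w_{ij})$ with $V_i$ as a storage function; b) for each $(i,j)$ such that $(G_i,G_j)\in\hat E$, $s_{ij}(v_{ij},w_{ij})+s_{ji}(v_{ji},w_{ji})=0$ whenever $v_{ij}=w_{ji}$ and $v_{ji}=w_{ij}$.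
   Context: Dynamical network. $\Gamma=(\Omega,E)$ is a finite directed graph (no self-loops) whose vertices $\Omega=\{G_1,\dots,G_N\}$ are linear time-invariant systems with states $x_i\in\mathbb{R}^{n_i}$. A directed edge $(G_i,G_j)\in E$ means that an output signal $w_{ij}$ of $G_i$ is an input signal $v_{ji}$ of $G_j$, with interconnection constraint $v_{ji}=w_{ij}$. The undirected graph $\hat\Gamma=(\Omega,\hat E)$ has an edge between $G_i$ and $G_j$ iff $(G_i,G_j)\in E$ or $(G_j,G_i)\in E$, and $\mathcal N_i=\{j:(G_i,G_j)\in\hat E\}$. Each $G_i$ has inputs $v_{ij}$ and outputs $w_{ij}$, $j\in\mathcal N_i$, and satisfies $\dot x_i=A_ix_i+\sum_{j\in\mathcal N_i}B_{ij}v_{ij}$, $w_{ij}=C_{ij}x_i+D_{ij}v_{ij}$ with real matrices (so there is no direct feed-through from $v_{ik}$ to $w_{il}$ for $k\neq l$). If $(G_i,G_j)\notin E$, the signals $w_{ij}$ and $v_{ji}$ are absent (zero-dimensional). The network is acyclic if $\hat\Gamma$ is an acyclic graph (a forest); in particular both $(G_i,G_j)$ and $(G_j,G_i)$ may belong to $E$. The network is well-posed if the interconnection constraints determine all interconnection signals uniquely from the states; then it has the form $\dot x=\mathcal A x$, $x=\mathrm{col}(x_1,\dots,x_N)$. (In case 2 the network is necessarily well-posed.) For symmetric $P_i\succ0$, the function $\sum_i x_i^\top P_ix_i$ is an additive quadratic Lyapunov function for the network if $\mathcal A^\top P+P\mathcal A\prec0$ with $P=\mathrm{diag}(P_1,\dots,P_N)$.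 "Quadratic function" means a quadratic form. A linear system $\dot x=Ax+Bv$, $w=Cx+Dv$ is strictly dissipative with respect to a quadratic supply function $s(v,w)$ with storage function $x^\top Px$ if $2x^\top P(Ax+Bv)<s(v,\,Cx+Dv)$ for all $(x,v)\neq0$. *)

theory Defs
  imports Jordan_Normal_Form.DL_Rank
begin

section \<open>Definiteness and quadratic forms\<close>

definition pos_def_mat :: "real mat \<Rightarrow> bool" where
  "pos_def_mat M \<longleftrightarrow> square_mat M \<and> transpose_mat M = M \<and>
     (\<forall>x \<in> carrier_vec (dim_row M). x \<noteq> 0\<^sub>v (dim_row M) \<longrightarrow> x \<bullet> (M *\<^sub>v x) > 0)"

definition neg_def_mat :: "real mat \<Rightarrow> bool" where
  "neg_def_mat M \<longleftrightarrow> pos_def_mat (- M)"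

definition quadratic_function :: "nat \<Rightarrow> nat \<Rightarrow> (real vec \<Rightarrow> real vec \<Rightarrow> real) \<Rightarrow> bool" where
  "quadratic_function p q s \<longleftrightarrow>
     (\<exists>S \<in> carrier_mat (p + q) (p + q). transpose_mat S = S \<and>
       (\<forall>v \<in> carrier_vec p. \<forall>w \<in> carrier_vec q. s v w = (v @\<^sub>v w) \<bullet> (S *\<^sub>v (v @\<^sub>v w))))"

definition full_row_rank :: "real mat \<Rightarrow> bool" where
  "full_row_rank M \<longleftrightarrow> vec_space.rank (dim_row M) M = dim_row M"

definition col_vec :: "real vec list \<Rightarrow> real vec" where
  "col_vec xs = foldr (@\<^sub>v) xs vNil"

section \<open>Dynamical networks\<close>

text \<open>The systems are numbered from \<open>0\<close>. \<open>sdim \<Gamma> i\<close> is the dimension of the state of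
  system \<open>i\<close>, and \<open>odim \<Gamma> i j\<close> that of the signal \<open>w\<^sub>i\<^sub>j\<close>. There is no separate field for
  the dimension of \<open>v\<^sub>i\<^sub>j\<close>: since \<open>w\<^sub>j\<^sub>i\<close> is fed into it, its dimension is \<open>odim \<Gamma> j i\<close>.
  An absent signal is a signal of dimension \<open>0\<close>.\<close>

record network =
  nsys :: nat
  edges :: "(nat \<times> nat) set"
  sdim :: "nat \<Rightarrow> nat"
  odim :: "nat \<Rightarrow> nat \<Rightarrow> nat"
  Amat :: "nat \<Rightarrow> real mat"
  Bmat :: "nat \<Rightarrow> nat \<Rightarrow> real mat"
  Cmat :: "nat \<Rightarrow> nat \<Rightarrow> real mat"
  Dmat :: "nat \<Rightarrow> nat \<Rightarrow> real mat"

definition uedges :: "network \<Rightarrow> (nat \<times> nat) set" where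
  "uedges \<Gamma> = edges \<Gamma> \<union> (edges \<Gamma>)\<inverse>"

definition nbrs :: "network \<Rightarrow> nat \<Rightarrow> nat set" where
  "nbrs \<Gamma> i = {j. (i, j) \<in> uedges \<Gamma>}"

definition is_network :: "network \<Rightarrow> bool" where
  "is_network \<Gamma> \<longleftrightarrow>
     edges \<Gamma> \<subseteq> {..<nsys \<Gamma>} \<times> {..<nsys \<Gamma>} \<and> irrefl (edges \<Gamma>) \<and>
     (\<forall>i < nsys \<Gamma>. Amat \<Gamma> i \<in> carrier_mat (sdim \<Gamma> i) (sdim \<Gamma> i)) \<and>
     (\<forall>i < nsys \<Gamma>. \<forall>j \<in> nbrs \<Gamma> i.
        ((i, j) \<notin> edges \<Gamma> \<longrightarrow> odim \<Gamma> i j = 0) \<and>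
        Bmat \<Gamma> i j \<in> carrier_mat (sdim \<Gamma> i) (odim \<Gamma> j i) \<and>
        Cmat \<Gamma> i j \<in> carrier_mat (odim \<Gamma> i j) (sdim \<Gamma> i) \<and>
        Dmat \<Gamma> i j \<in> carrier_mat (odim \<Gamma> i j) (odim \<Gamma> j i))"

text \<open>A cycle of the undirected graph has at least three vertices; two opposite edges of the
  directed graph form a single undirected edge. The constant \<open>forest\<close> of the AFP entry
  \<open>Graph_Theory\<close> counts such a pair as a cycle.\<close>

definition acyclic_network :: "network \<Rightarrow> bool" where
  "acyclic_network \<Gamma> \<longleftrightarrow>
     \<not> (\<exists>c. length c \<ge> 3 \<and> distinct c \<and>
          (\<forall>k < length c. (c ! k, c ! (Suc k mod length c)) \<in> uedges \<Gamma>))"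

section \<open>Interconnection\<close>

definition xdot :: "network \<Rightarrow> nat \<Rightarrow> real vec \<Rightarrow> (nat \<Rightarrow> real vec) \<Rightarrow> real vec" where
  "xdot \<Gamma> i x v = Amat \<Gamma> i *\<^sub>v x + finsum_vec TYPE(real) (sdim \<Gamma> i) (\<lambda>j. Bmat \<Gamma> i j *\<^sub>v v j) (nbrs \<Gamma> i)"

definition outp :: "network \<Rightarrow> nat \<Rightarrow> nat \<Rightarrow> real vec \<Rightarrow> real vec \<Rightarrow> real vec" where
  "outp \<Gamma> i j x v = Cmat \<Gamma> i j *\<^sub>v x + Dmat \<Gamma> i j *\<^sub>v v"

definition states :: "network \<Rightarrow> (nat \<Rightarrow> real vec) \<Rightarrow> bool" where
  "states \<Gamma> x \<longleftrightarrow> (\<forall>i < nsys \<Gamma>. x i \<in> carrier_vec (sdim \<Gamma> i))"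

definition signals :: "network \<Rightarrow> (nat \<Rightarrow> real vec) \<Rightarrow> (nat \<Rightarrow> nat \<Rightarrow> real vec) \<Rightarrow> (nat \<Rightarrow> nat \<Rightarrow> real vec) \<Rightarrow> bool" where
  "signals \<Gamma> x v w \<longleftrightarrow>
     (\<forall>i < nsys \<Gamma>. \<forall>j \<in> nbrs \<Gamma> i.
        v i j \<in> carrier_vec (odim \<Gamma> j i) \<and> w i j \<in> carrier_vec (odim \<Gamma> i j) \<and>
        w i j = outp \<Gamma> i j (x i) (v i j)) \<and>
     (\<forall>(i, j) \<in> edges \<Gamma>. v j i = w i j)"

definition well_posed :: "network \<Rightarrow> bool" where
  "well_posed \<Gamma> \<longleftrightarrow>
     (\<forall>x. states \<Gamma> x \<longrightarrow>
        (\<exists>v w. signals \<Gamma> x v w \<and>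
           (\<forall>v' w'. signals \<Gamma> x v' w' \<longrightarrow>
              (\<forall>i < nsys \<Gamma>. \<forall>j \<in> nbrs \<Gamma> i. v' i j = v i j \<and> w' i j = w i j))))"

definition state_col :: "network \<Rightarrow> (nat \<Rightarrow> real vec) \<Rightarrow> real vec" where
  "state_col \<Gamma> x = col_vec (map x [0..<nsys \<Gamma>])"

definition state_dim :: "network \<Rightarrow> nat" where
  "state_dim \<Gamma> = (\<Sum>i < nsys \<Gamma>. sdim \<Gamma> i)"

definition closed_loop :: "network \<Rightarrow> real mat \<Rightarrow> bool" where
  "closed_loop \<Gamma> \<A> \<longleftrightarrow> \<A> \<in> carrier_mat (state_dim \<Gamma>) (state_dim \<Gamma>) \<and>
     (\<forall>x v w. states \<Gamma> x \<longrightarrow> signals \<Gamma> x v w \<longrightarrow>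
        state_col \<Gamma> (\<lambda>i. xdot \<Gamma> i (x i) (v i)) = \<A> *\<^sub>v state_col \<Gamma> x)"

section \<open>Lyapunov functions and dissipativity\<close>

text \<open>\<open>P i\<close> is the matrix of \<open>V\<^sub>i(x\<^sub>i) = x\<^sub>i \<bullet> P\<^sub>i x\<^sub>i\<close>. In a well-posed network there is exactly
  one \<open>\<A>\<close> with \<open>closed_loop \<Gamma> \<A>\<close>.\<close>

definition additive_quadratic_lyapunov :: "network \<Rightarrow> (nat \<Rightarrow> real mat) \<Rightarrow> bool" where
  "additive_quadratic_lyapunov \<Gamma> P \<longleftrightarrow>
     (\<exists>\<A>. closed_loop \<Gamma> \<A> \<and>
        (let Q = diag_block_mat (map P [0..<nsys \<Gamma>])
         in neg_def_mat (transpose_mat \<A> * Q + Q * \<A>)))"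

definition strictly_dissipative ::
    "network \<Rightarrow> nat \<Rightarrow> real mat \<Rightarrow> (nat \<Rightarrow> real vec \<Rightarrow> real vec \<Rightarrow> real) \<Rightarrow> bool" where
  "strictly_dissipative \<Gamma> i R s \<longleftrightarrow>
     (\<forall>x v. x \<in> carrier_vec (sdim \<Gamma> i) \<longrightarrow>
        (\<forall>j \<in> nbrs \<Gamma> i. v j \<in> carrier_vec (odim \<Gamma> j i)) \<longrightarrow>
        (x \<noteq> 0\<^sub>v (sdim \<Gamma> i) \<or> (\<exists>j \<in> nbrs \<Gamma> i. v j \<noteq> 0\<^sub>v (odim \<Gamma> j i))) \<longrightarrow>
        2 * (x \<bullet> (R *\<^sub>v xdot \<Gamma> i x v)) < (\<Sum>j \<in> nbrs \<Gamma> i. s j (v j) (outp \<Gamma> i j x (v j))))"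

end

theory Submission
  imports Defs "HOL-Analysis.Function_Topology"
begin

text \<open>Summing the dissipation inequalities over the network gives (i) from (ii). For the converse,
  let \<open>F\<^sub>i(x\<^sub>i, v\<^sub>i)\<close> be the derivative of \<open>V\<^sub>i\<close> along \<open>G\<^sub>i\<close>, with the interconnection signals regarded as
  independent variables. By well-posedness, (i) says that \<open>\<Sum>\<^sub>i F\<^sub>i\<close> is negative definite on the subspace
  of interconnected signals. Finsler's lemma replaces the subspace by a penalty: the form
  \<open>\<Sum>\<^sub>i F\<^sub>i - c \<cdot> (squared interconnection defects)\<close> is negative definite on all states and signals, with some
  margin. A forest has a leaf \<open>i\<close>; it is attached to at most one \<open>j\<close>. Maximising the form over the
  variables of \<open>G\<^sub>i\<close> leaves a quadratic form in the signals on the edge between \<open>G\<^sub>i\<close> and \<open>G\<^sub>j\<close>. This is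
  \<open>s\<^sub>i\<^sub>j\<close>, and \<open>s\<^sub>j\<^sub>i = - s\<^sub>i\<^sub>j\<close>. Adding \<open>s\<^sub>i\<^sub>j\<close> to \<open>F\<^sub>j\<close> keeps the form of the remaining network negative
  definite, so the argument can be repeated without \<open>G\<^sub>i\<close>.\<close>

section \<open>Linear and quadratic forms in finitely many coordinates\<close>

text \<open>The penalty makes the elimination of a leaf unconditional. If the signals on the edge
  were prescribed exactly, the maximum over the leaf would exist only for signals that the leaf can
  produce. With the penalty every vector p of edge signals is admissible, the form is negative
  definite in the variables of the leaf, and the maximum g(p) of F_i(z) - 2c |L_ij z - p|^2 over z
  is a quadratic form in p. This one form serves twice. At the leaf's own signals p = L_ij z the
  penalty vanishes, which leaves the dissipation inequality F_i(z) \<le> g(L_ij z). At the signals p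
  = L_ji f seen by the neighbour, g is the largest share of the leaf in the penalised form, so the
  network with F_j + g in place of F_j stays negative definite.

  Maxima give only non-strict inequalities. Strictness, also at zero state and nonzero inputs, is
  paid for by the margin from Finsler's lemma, which is divided among the systems before the
  elimination. Well-posedness is what turns negativity for nonzero states into negativity for all
  nonzero variables on the subspace: a zero state forces zero signals.\<close>

definition lin_form :: "'a set \<Rightarrow> (('a \<Rightarrow> real) \<Rightarrow> real) \<Rightarrow> bool" where
  "lin_form I l \<longleftrightarrow> (\<exists>c. \<forall>f. l f = (\<Sum>a\<in>I. c a * f a))"

text \<open>A vector is a total function on an arbitrary index type, of which a form reads only the
  entries in \<open>I\<close>. Forms of different systems thus live on one space, and coordinates
  can be overwritten or forgotten without a change of dimension. The coefficients \<open>M\<close>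
  are not assumed symmetric.\<close>

definition quad_form :: "'a set \<Rightarrow> (('a \<Rightarrow> real) \<Rightarrow> real) \<Rightarrow> bool" where
  "quad_form I q \<longleftrightarrow> (\<exists>M. \<forall>f. q f = (\<Sum>a\<in>I. \<Sum>b\<in>I. M a b * f a * f b))"

lemma lin_form_cong: "lin_form I l \<Longrightarrow> (\<And>a. a \<in> I \<Longrightarrow> f a = g a) \<Longrightarrow> l f = l g"
  unfolding lin_form_def by auto

lemma quad_form_cong: "quad_form I q \<Longrightarrow> (\<And>a. a \<in> I \<Longrightarrow> f a = g a) \<Longrightarrow> q f = q g"
  unfolding quad_form_def by auto

lemma lin_form_zero: "lin_form I l \<Longrightarrow> (\<And>a. a \<in> I \<Longrightarrow> f a = 0) \<Longrightarrow> l f = 0"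
  unfolding lin_form_def by auto

lemma quad_form_zero: "quad_form I q \<Longrightarrow> (\<And>a. a \<in> I \<Longrightarrow> f a = 0) \<Longrightarrow> q f = 0"
  unfolding quad_form_def by auto

lemma quad_form_scale_arg: "quad_form I q \<Longrightarrow> q (\<lambda>a. c * f a) = c\<^sup>2 * q f"
  unfolding quad_form_def
  by (auto simp: sum_distrib_left power2_eq_square algebra_simps intro!: sum.cong)

lemma lin_form_coord: "finite I \<Longrightarrow> a \<in> I \<Longrightarrow> lin_form I (\<lambda>f. f a)"
  unfolding lin_form_def
  by (rule exI[of _ "\<lambda>b. if b = a then 1 else 0"]) (simp add: if_distrib[of "\<lambda>x. x * _"] cong: if_cong)

lemma lin_form_0: "lin_form I (\<lambda>f. 0)"
  unfolding lin_form_def by (rule exI[of _ "\<lambda>_. 0"]) simp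

lemma lin_form_add:
  assumes "lin_form I l" "lin_form I m" shows "lin_form I (\<lambda>f. l f + m f)"
proof -
  obtain c d where "\<And>f. l f = (\<Sum>a\<in>I. c a * f a)" "\<And>f. m f = (\<Sum>a\<in>I. d a * f a)"
    using assms unfolding lin_form_def by auto
  then show ?thesis unfolding lin_form_def
    by (intro exI[of _ "\<lambda>a. c a + d a"]) (simp add: algebra_simps sum.distrib)
qed

lemma lin_form_scale:
  assumes "lin_form I l" shows "lin_form I (\<lambda>f. k * l f)"
proof -
  obtain c where "\<And>f. l f = (\<Sum>a\<in>I. c a * f a)"
    using assms unfolding lin_form_def by auto
  then show ?thesis unfolding lin_form_def
    by (intro exI[of _ "\<lambda>a. k * c a"]) (simp add: algebra_simps sum_distrib_left)
qed

lemma lin_form_diff: "lin_form I l \<Longrightarrow> lin_form I m \<Longrightarrow> lin_form I (\<lambda>f. l f - m f)"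
  using lin_form_add[of I l "\<lambda>f. (-1) * m f"] lin_form_scale[of I m "-1"] by simp

lemma lin_form_sum: "(\<And>i. i \<in> S \<Longrightarrow> lin_form I (l i)) \<Longrightarrow> lin_form I (\<lambda>f. \<Sum>i\<in>S. l i f)"
  by (induction S rule: infinite_finite_induct) (auto intro: lin_form_0 lin_form_add)

lemma quad_form_0: "quad_form I (\<lambda>f. 0)"
  unfolding quad_form_def by (rule exI[of _ "\<lambda>_ _. 0"]) simp

lemma quad_form_add:
  assumes "quad_form I q" "quad_form I r" shows "quad_form I (\<lambda>f. q f + r f)"
proof -
  obtain M N where "\<And>f. q f = (\<Sum>a\<in>I. \<Sum>b\<in>I. M a b * f a * f b)"
    "\<And>f. r f = (\<Sum>a\<in>I. \<Sum>b\<in>I. N a b * f a * f b)"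
    using assms unfolding quad_form_def by auto
  then show ?thesis unfolding quad_form_def
    by (intro exI[of _ "\<lambda>a b. M a b + N a b"]) (simp add: algebra_simps sum.distrib)
qed

lemma quad_form_scale:
  assumes "quad_form I q" shows "quad_form I (\<lambda>f. k * q f)"
proof -
  obtain M where "\<And>f. q f = (\<Sum>a\<in>I. \<Sum>b\<in>I. M a b * f a * f b)"
    using assms unfolding quad_form_def by auto
  then show ?thesis unfolding quad_form_def
    by (intro exI[of _ "\<lambda>a b. k * M a b"]) (simp add: algebra_simps sum_distrib_left)
qed

lemma quad_form_diff: "quad_form I q \<Longrightarrow> quad_form I r \<Longrightarrow> quad_form I (\<lambda>f. q f - r f)"
  using quad_form_add[of I q "\<lambda>f. (-1) * r f"] quad_form_scale[of I r "-1"] by simp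

lemma quad_form_sum: "(\<And>i. i \<in> S \<Longrightarrow> quad_form I (q i)) \<Longrightarrow> quad_form I (\<lambda>f. \<Sum>i\<in>S. q i f)"
  by (induction S rule: infinite_finite_induct) (auto intro: quad_form_0 quad_form_add)

lemma quad_form_mult:
  assumes "lin_form I l" "lin_form I m" shows "quad_form I (\<lambda>f. l f * m f)"
proof -
  obtain c d where "\<And>f. l f = (\<Sum>a\<in>I. c a * f a)" "\<And>f. m f = (\<Sum>a\<in>I. d a * f a)"
    using assms unfolding lin_form_def by auto
  then show ?thesis unfolding quad_form_def
    by (intro exI[of _ "\<lambda>a b. c a * d b"]) (simp add: sum_product algebra_simps)
qed

lemma quad_form_power2: "lin_form I l \<Longrightarrow> quad_form I (\<lambda>f. (l f)\<^sup>2)"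
  unfolding power2_eq_square by (rule quad_form_mult)

lemma lin_form_comp:
  assumes "lin_form K l" "\<And>k. k \<in> K \<Longrightarrow> lin_form I (L k)"
  shows "lin_form I (\<lambda>f. l (\<lambda>k. L k f))"
proof -
  obtain c where "\<And>f. l f = (\<Sum>a\<in>K. c a * f a)"
    using assms(1) unfolding lin_form_def by auto
  then show ?thesis using assms(2) by (auto intro!: lin_form_sum lin_form_scale)
qed

lemma quad_form_comp:
  assumes "quad_form K q" "\<And>k. k \<in> K \<Longrightarrow> lin_form I (L k)"
  shows "quad_form I (\<lambda>f. q (\<lambda>k. L k f))"
proof -
  obtain M where "\<And>f. q f = (\<Sum>a\<in>K. \<Sum>b\<in>K. M a b * f a * f b)"
    using assms(1) unfolding quad_form_def by auto
  then show ?thesis using assms(2) by (auto intro!: quad_form_sum quad_form_mult lin_form_scale)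
qed

lemma lin_form_mono: "lin_form I l \<Longrightarrow> I \<subseteq> J \<Longrightarrow> finite J \<Longrightarrow> lin_form J l"
  using lin_form_comp[of I l J "\<lambda>k f. f k"] by (auto intro: lin_form_coord)

lemma quad_form_mono: "quad_form I q \<Longrightarrow> I \<subseteq> J \<Longrightarrow> finite J \<Longrightarrow> quad_form J q"
  using quad_form_comp[of I q J "\<lambda>k f. f k"] by (auto intro: lin_form_coord)

lemma quad_form_insertE:
  assumes "quad_form (insert a I) q" "a \<notin> I" "finite I"
  obtains m l r where "lin_form I l" "quad_form I r" "\<And>f. q f = m * (f a)\<^sup>2 + 2 * f a * l f + r f"
proof -
  obtain M where M: "\<And>f. q f = (\<Sum>x\<in>insert a I. \<Sum>y\<in>insert a I. M x y * f x * f y)"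
    using assms(1) unfolding quad_form_def by auto
  \<comment> \<open>\<open>M\<close> need not be symmetric, hence the average of the two mixed
    coefficients.\<close>
  define l where "l = (\<lambda>f. \<Sum>x\<in>I. ((M a x + M x a) / 2) * f x)"
  define r where "r = (\<lambda>f. \<Sum>x\<in>I. \<Sum>y\<in>I. M x y * f x * f y)"
  have "lin_form I l" unfolding l_def lin_form_def by (rule exI) (rule allI, rule refl)
  moreover have "quad_form I r" unfolding r_def quad_form_def by (rule exI) (rule allI, rule refl)
  moreover have "q f = M a a * (f a)\<^sup>2 + 2 * f a * l f + r f" for f
  proof -
    have "2 * f a * l f = (\<Sum>x\<in>I. M a x * f a * f x) + (\<Sum>x\<in>I. M x a * f x * f a)"
      unfolding l_def sum_distrib_left sum.distrib[symmetric] by (rule sum.cong) (auto simp: field_simps)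
    then show ?thesis unfolding M r_def using assms(2,3)
      by (simp add: sum.distrib power2_eq_square)
  qed
  ultimately show thesis by (rule that)
qed

section \<open>Partial maximisation of quadratic forms\<close>

text \<open>Completing the square: the maximum over one coordinate is a quadratic form in the others.\<close>

lemma quad_form_eliminate_coord:
  assumes q: "quad_form (insert a I) q" "a \<notin> I" "finite I"
    and neg: "\<And>f. f a \<noteq> 0 \<Longrightarrow> (\<And>b. b \<in> I \<Longrightarrow> f b = 0) \<Longrightarrow> q f < 0"
  obtains g where "quad_form I g" "\<And>f. q f \<le> g f" "\<And>f :: 'a \<Rightarrow> real. \<exists>t. q (f(a := t)) = g f"
proof -
  obtain m l r where l: "lin_form I l" and r: "quad_form I r"
    and qe: "\<And>f. q f = m * (f a)\<^sup>2 + 2 * f a * l f + r f"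
    using quad_form_insertE[OF q] by metis
  \<comment> \<open>Evaluation at the unit vector in direction \<open>a\<close> identifies
    \<open>m\<close> and shows that it is negative.\<close>
  let ?e = "\<lambda>b. if b = a then 1 else 0 :: real"
  have "q ?e = m" unfolding qe using q(2) lin_form_zero[OF l, of ?e] quad_form_zero[OF r, of ?e] by fastforce
  moreover have "q ?e < 0" using q(2) by (intro neg) auto
  ultimately have m: "m < 0" by simp
  define g where "g f = r f - inverse m * (l f)\<^sup>2" for f
  have "quad_form I g" unfolding g_def
    by (intro quad_form_diff r quad_form_scale quad_form_power2 l)
  moreover have sq: "q f = g f + m * (f a + l f / m)\<^sup>2" for f
    unfolding qe g_def using m by (simp add: power2_eq_square field_simps)
  then have "q f \<le> g f" for f using m by (simp add: mult_nonpos_nonneg)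
  moreover have "\<exists>t. q (f(a := t)) = g f" for f
  proof
    \<comment> \<open>The vertex of the parabola in the coordinate \<open>a\<close>, which neither
      \<open>l\<close> nor \<open>g\<close> reads.\<close>
    have "l (f(a := - l f / m)) = l f" "g (f(a := - l f / m)) = g f"
      using q(2) by (auto intro: lin_form_cong[OF l] quad_form_cong[OF \<open>quad_form I g\<close>])
    then show "q (f(a := - l f / m)) = g f" unfolding sq by simp
  qed
  ultimately show thesis by (rule that)
qed

text \<open>One coordinate is maximised out at a time. The reduced form is a value of
  \<open>q\<close> at a point that differs only in the removed coordinate, so it is again negative
  when the coordinates in \<open>J\<close> vanish and one of the remaining ones in \<open>A\<close>
  does not. The hypothesis therefore survives the induction.\<close>

lemma quad_form_eliminate:
  assumes "finite A" "finite J" "A \<inter> J = {}" "quad_form (A \<union> J) q"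
    and "\<And>f. (\<And>b. b \<in> J \<Longrightarrow> f b = 0) \<Longrightarrow> \<exists>a\<in>A. f a \<noteq> 0 \<Longrightarrow> q f < 0"
  shows "\<exists>g. quad_form J g \<and> (\<forall>f. q f \<le> g f) \<and> (\<forall>f. \<exists>h. (\<forall>b. b \<notin> A \<longrightarrow> h b = f b) \<and> q h = g f)"
  using assms
proof (induction A arbitrary: q rule: finite_induct)
  case empty
  then show ?case by auto
next
  case (insert a A)
  have a: "a \<notin> A \<union> J" "finite (A \<union> J)" using insert by auto
  obtain q' where q': "quad_form (A \<union> J) q'" "\<And>f. q f \<le> q' f" "\<And>f :: 'a \<Rightarrow> real. \<exists>t. q (f(a := t)) = q' f"
  proof (rule quad_form_eliminate_coord[of a "A \<union> J" q])
    show "quad_form (insert a (A \<union> J)) q" using insert.prems by simp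
    show "q f < 0" if "f a \<noteq> 0" "\<And>b. b \<in> A \<union> J \<Longrightarrow> f b = 0" for f
      using that by (intro insert.prems) auto
  qed (use a in auto)
  have "\<exists>g. quad_form J g \<and> (\<forall>f. q' f \<le> g f) \<and> (\<forall>f. \<exists>h. (\<forall>b. b \<notin> A \<longrightarrow> h b = f b) \<and> q' h = g f)"
  proof (rule insert.IH)
    fix f :: "'a \<Rightarrow> real" assume f: "\<And>b. b \<in> J \<Longrightarrow> f b = 0" "\<exists>a\<in>A. f a \<noteq> 0"
    obtain t where t: "q (f(a := t)) = q' f" using q'(3) by blast
    obtain a' where "a' \<in> A" "f a' \<noteq> 0" using f(2) by blast
    moreover from this have "a' \<noteq> a" using insert.hyps by blast
    ultimately have "q (f(a := t)) < 0" using f(1) a by (intro insert.prems) auto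
    then show "q' f < 0" using t by simp
  qed (use insert.prems q' in auto)
  then obtain g where g: "quad_form J g" "\<And>f. q' f \<le> g f"
    "\<And>f. \<exists>h. (\<forall>b. b \<notin> A \<longrightarrow> h b = f b) \<and> q' h = g f" by blast
  have "\<exists>h. (\<forall>b. b \<notin> insert a A \<longrightarrow> h b = f b) \<and> q h = g f" for f :: "'a \<Rightarrow> real"
  proof -
    obtain h where h: "\<forall>b. b \<notin> A \<longrightarrow> h b = f b" "q' h = g f" using g(3) by blast
    obtain t where "q (h(a := t)) = q' h" using q'(3) by blast
    then show ?thesis using h by (intro exI[of _ "h(a := t)"]) auto
  qed
  then show ?case using g q'(2) order_trans by blast
qed

section \<open>Compactness of the sphere and Finsler's lemma\<close>

lemma quad_form_continuous:
  assumes "quad_form I q" shows "continuous_on S q"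
proof -
  obtain M where M: "\<And>f. q f = (\<Sum>a\<in>I. \<Sum>b\<in>I. M a b * f a * f b)"
    using assms unfolding quad_form_def by auto
  have "continuous_on S (\<lambda>f. \<Sum>a\<in>I. \<Sum>b\<in>I. M a b * f a * f b)"
    by (intro continuous_intros continuous_on_subset[OF continuous_on_product_coordinates] subset_UNIV)
  then show ?thesis unfolding M[abs_def] .
qed

text \<open>The topology on functions is the product topology; unless \<open>f\<close> is made to
  vanish off \<open>I\<close>, the set is unbounded in the remaining coordinates.\<close>

definition coord_sphere :: "'a set \<Rightarrow> ('a \<Rightarrow> real) set" where
  "coord_sphere I = {f. (\<forall>a. a \<notin> I \<longrightarrow> f a = 0) \<and> (\<Sum>a\<in>I. (f a)\<^sup>2) = 1}"

lemma quad_form_sum_squares: "finite I \<Longrightarrow> quad_form I (\<lambda>f. \<Sum>a\<in>I. (f a)\<^sup>2)"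
  by (intro quad_form_sum quad_form_power2 lin_form_coord)

text \<open>A closed subset of a product of compact intervals, degenerate outside \<open>I\<close>,
  so Tychonoff's theorem applies.\<close>

lemma compact_coord_sphere:
  assumes "finite I" shows "compact (coord_sphere I)"
proof -
  let ?B = "PiE UNIV (\<lambda>a. if a \<in> I then {-1..1} else {0::real})"
  have "compactin (product_topology (\<lambda>_. euclidean) UNIV) ?B"
    by (subst compactin_PiE) auto
  then have B: "compact ?B" unfolding euclidean_product_topology by simp
  have "closed {f. (\<Sum>a\<in>I. (f a)\<^sup>2) = (1::real)}"
    by (intro closed_Collect_eq quad_form_continuous[OF quad_form_sum_squares] continuous_on_const assms)
  moreover have "coord_sphere I = ?B \<inter> {f. (\<Sum>a\<in>I. (f a)\<^sup>2) = 1}"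
  proof -
    have "\<bar>f a\<bar> \<le> 1" if "(\<Sum>a\<in>I. (f a)\<^sup>2) = 1" "a \<in> I" for f :: "'a \<Rightarrow> real" and a
    proof -
      have "(f a)\<^sup>2 \<le> 1" using member_le_sum[OF that(2), of "\<lambda>a. (f a)\<^sup>2"] that assms by simp
      then show ?thesis using abs_square_le_1 by blast
    qed
    then have "f \<in> ?B" if "f \<in> coord_sphere I" for f
      using that unfolding coord_sphere_def PiE_UNIV_domain Pi_def by (simp add: abs_le_iff)
    moreover have "f a = 0" if "f \<in> ?B" "a \<notin> I" for f a
      using PiE_mem[OF that(1), of a] that(2) by simp
    ultimately show ?thesis unfolding coord_sphere_def by blast
  qed
  ultimately show ?thesis using B by (simp add: compact_Int_closed)
qed

text \<open>Homogeneity: cutting \<open>f\<close> off outside \<open>I\<close> leaves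
  \<open>q f\<close> unchanged, and scaling to length one multiplies it by a positive
  factor.\<close>

lemma quad_form_neg_on_sphere:
  assumes "finite I" "quad_form I q" "\<And>f. f \<in> coord_sphere I \<Longrightarrow> q f < 0" "\<exists>a\<in>I. f a \<noteq> 0"
  shows "q f < 0"
proof -
  let ?s = "\<Sum>a\<in>I. (f a)\<^sup>2"
  have s: "?s > 0" using assms(1,4) by (metis (mono_tags, lifting) sum_pos2 zero_le_power2 zero_less_power2)
  let ?g = "\<lambda>a. if a \<in> I then f a else 0"
  let ?h = "\<lambda>a. (1 / sqrt ?s) * ?g a"
  have "?h \<in> coord_sphere I" unfolding coord_sphere_def
    using s by (simp add: power_divide sum_divide_distrib[symmetric])
  then have "q ?h < 0" by (rule assms(3))
  then have "(1 / sqrt ?s)\<^sup>2 * q ?g < 0" by (simp only: quad_form_scale_arg[OF assms(2)])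
  then have "q ?g < 0" using s by (simp add: mult_less_0_iff)
  then show ?thesis using quad_form_cong[OF assms(2), of f ?g] by simp
qed

text \<open>Compactness gives both constants. Where \<open>q\<close> is negative on the sphere, any
  positive multiple of \<open>r\<close> may be subtracted. On the compact remainder \<open>r\<close>
  is positive, hence bounded away from 0, and a large multiple of it dominates \<open>q\<close>. The
  negative maximum that results leaves room for \<open>\<epsilon>\<close>.\<close>

lemma finsler_strict:
  assumes I: "finite I" and q: "quad_form I q" and r: "quad_form I r" "\<And>f. r f \<ge> 0"
    and neg: "\<And>f. r f = 0 \<Longrightarrow> \<exists>a\<in>I. f a \<noteq> 0 \<Longrightarrow> q f < 0"
  shows "\<exists>c \<epsilon>. 0 < c \<and> 0 < \<epsilon> \<and> (\<forall>f. (\<exists>a\<in>I. f a \<noteq> 0) \<longrightarrow> q f + \<epsilon> * (\<Sum>a\<in>I. (f a)\<^sup>2) - c * r f < 0)"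
proof (cases "coord_sphere I = {}")
  case True
  have "q f + 1 * (\<Sum>a\<in>I. (f a)\<^sup>2) - 1 * r f < 0" if "\<exists>a\<in>I. f a \<noteq> 0" for f
    by (rule quad_form_neg_on_sphere[OF I _ _ that])
      (auto simp: True intro!: quad_form_diff quad_form_add q r quad_form_sum_squares I quad_form_scale)
  then show ?thesis by (intro exI[of _ 1]) auto
next
  case ne: False
  let ?S = "coord_sphere I"
  have S: "compact ?S" by (rule compact_coord_sphere[OF I])
  have nz: "\<exists>a\<in>I. f a \<noteq> 0" if "f \<in> ?S" for f
    using that unfolding coord_sphere_def by (auto intro: ccontr)
  obtain c where c: "c > 0" "\<And>f. f \<in> ?S \<Longrightarrow> q f - c * r f < 0"
  proof (cases "?S \<inter> {f. 0 \<le> q f} = {}")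
    case True
    have "q f - 1 * r f < 0" if "f \<in> ?S" for f using True that r(2)[of f] by force
    then show thesis using that[of 1] by auto
  next
    case False
    let ?T = "?S \<inter> {f. 0 \<le> q f}"
    have T: "compact ?T"
      by (intro compact_Int_closed S closed_Collect_le continuous_on_const quad_form_continuous[OF q])
    obtain f0 where f0: "f0 \<in> ?T" "\<And>f. f \<in> ?T \<Longrightarrow> r f0 \<le> r f"
      using continuous_attains_inf[OF T False quad_form_continuous[OF r(1)]] by blast
    obtain f1 where f1: "f1 \<in> ?T" "\<And>f. f \<in> ?T \<Longrightarrow> q f \<le> q f1"
      using continuous_attains_sup[OF T False quad_form_continuous[OF q]] by blast
    have r0: "r f0 > 0" using neg[of f0] f0(1) nz[of f0] r(2)[of f0] by (auto simp: less_le)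
    \<comment> \<open>The largest \<open>q\<close> over the smallest \<open>r\<close> on
      \<open>?T\<close>; the added 1 makes the result strict and \<open>c\<close> positive.\<close>
    define c where "c = (q f1 + 1) / r f0"
    have "c > 0" unfolding c_def using r0 f1(1) by (auto intro: divide_pos_pos)
    moreover have "q f - c * r f < 0" if "f \<in> ?S" for f
    proof (cases "q f < 0")
      case True then show ?thesis using \<open>c > 0\<close> r(2)[of f] by (smt (verit) mult_nonneg_nonneg)
    next
      case False
      then have "f \<in> ?T" using that by simp
      have "c * r f0 \<le> c * r f" using f0(2)[OF \<open>f \<in> ?T\<close>] \<open>c > 0\<close> by simp
      moreover have "c * r f0 = q f1 + 1" unfolding c_def using r0 by simp
      ultimately show ?thesis using f1(2)[OF \<open>f \<in> ?T\<close>] by simp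
    qed
    ultimately show thesis by (rule that)
  qed
  have qc: "quad_form I (\<lambda>f. q f - c * r f)" by (intro quad_form_diff quad_form_scale q r)
  obtain f2 where f2: "f2 \<in> ?S" "\<And>f. f \<in> ?S \<Longrightarrow> q f - c * r f \<le> q f2 - c * r f2"
    using continuous_attains_sup[OF S ne quad_form_continuous[OF qc]] by blast
  \<comment> \<open>Half the distance from the maximum to 0, so adding \<open>\<epsilon>\<close> on
    the unit sphere keeps the form negative.\<close>
  define \<epsilon> where "\<epsilon> = - (q f2 - c * r f2) / 2"
  have e: "\<epsilon> > 0" unfolding \<epsilon>_def using c(2)[OF f2(1)] by simp
  have "q f + \<epsilon> * (\<Sum>a\<in>I. (f a)\<^sup>2) - c * r f < 0" if "\<exists>a\<in>I. f a \<noteq> 0" for f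
  proof (rule quad_form_neg_on_sphere[OF I _ _ that])
    show "quad_form I (\<lambda>f. q f + \<epsilon> * (\<Sum>a\<in>I. (f a)\<^sup>2) - c * r f)"
      by (intro quad_form_diff quad_form_add q r quad_form_sum_squares I quad_form_scale)
    show "q f + \<epsilon> * (\<Sum>a\<in>I. (f a)\<^sup>2) - c * r f < 0" if "f \<in> ?S" for f
    proof -
      have "(\<Sum>a\<in>I. (f a)\<^sup>2) = 1" using that unfolding coord_sphere_def by simp
      then have "q f + \<epsilon> * (\<Sum>a\<in>I. (f a)\<^sup>2) - c * r f = (q f - c * r f) + \<epsilon>" by simp
      also have "\<dots> < 0" using f2(2)[OF that] e unfolding \<epsilon>_def by argo
      finally show ?thesis .
    qed
  qed
  then show ?thesis using c(1) e by blast
qed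

section \<open>Splitting a negative definite form along a forest\<close>

text \<open>The targets \<open>p\<close> are adjoined to \<open>z\<close> as further coordinates
  (\<open>Inr\<close>) and the original ones (\<open>Inl\<close>) are eliminated; at
  \<open>p\<close> = 0 the form is the one assumed negative, as the elimination requires. Both
  properties of the maximum \<open>g p\<close> are recorded: the bound yields the dissipation
  inequality of the leaf, the attainment keeps the form of the remaining network negative.\<close>

lemma leaf_supply:
  fixes F :: "('a \<Rightarrow> real) \<Rightarrow> real" and L :: "'k \<Rightarrow> ('a \<Rightarrow> real) \<Rightarrow> real"
  assumes I: "finite I" and K: "finite K" and F: "quad_form I F"
    and L: "\<And>k. k \<in> K \<Longrightarrow> lin_form I (L k)"
    and neg: "\<And>z. \<exists>a\<in>I. z a \<noteq> 0 \<Longrightarrow> F z - c * (\<Sum>k\<in>K. (L k z)\<^sup>2) < 0"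
  shows "\<exists>g. quad_form K g \<and> (\<forall>z p. F z - c * (\<Sum>k\<in>K. (L k z - p k)\<^sup>2) \<le> g p) \<and>
    (\<forall>p. \<exists>z. F z - c * (\<Sum>k\<in>K. (L k z - p k)\<^sup>2) = g p)"
proof -
  let ?A = "Inl ` I" and ?J = "Inr ` K :: ('a + 'k) set"
  define q where "q h = F (\<lambda>a. h (Inl a)) - c * (\<Sum>k\<in>K. (L k (\<lambda>a. h (Inl a)) - h (Inr k))\<^sup>2)" for h :: "'a + 'k \<Rightarrow> real"
  have "\<exists>G. quad_form ?J G \<and> (\<forall>f. q f \<le> G f) \<and> (\<forall>f. \<exists>h. (\<forall>b. b \<notin> ?A \<longrightarrow> h b = f b) \<and> q h = G f)"
  proof (rule quad_form_eliminate)
    have coord: "lin_form (?A \<union> ?J) (\<lambda>h. h x)" if "x \<in> ?A \<union> ?J" for x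
      using I K that by (intro lin_form_coord) simp_all
    have "quad_form (?A \<union> ?J) (\<lambda>h. F (\<lambda>a. h (Inl a)))"
      using coord by (intro quad_form_comp[OF F]) simp
    moreover have "lin_form (?A \<union> ?J) (\<lambda>h. L k (\<lambda>a. h (Inl a)) - h (Inr k))" if "k \<in> K" for k
      using coord that by (intro lin_form_diff lin_form_comp[OF L[OF that]]) simp_all
    ultimately show "quad_form (?A \<union> ?J) q" unfolding q_def
      by (intro quad_form_diff quad_form_scale quad_form_sum quad_form_power2)
    fix h :: "'a + 'k \<Rightarrow> real" assume h: "\<And>b. b \<in> ?J \<Longrightarrow> h b = 0" "\<exists>a\<in>?A. h a \<noteq> 0"
    have "F (\<lambda>a. h (Inl a)) - c * (\<Sum>k\<in>K. (L k (\<lambda>a. h (Inl a)))\<^sup>2) < 0"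
      using h(2) by (intro neg) auto
    then show "q h < 0" unfolding q_def using h(1) by simp
  qed (use I K in auto)
  then obtain G where G: "quad_form ?J G" "\<And>f. q f \<le> G f"
      "\<And>f. \<exists>h. (\<forall>b. b \<notin> ?A \<longrightarrow> h b = f b) \<and> q h = G f" by blast
  \<comment> \<open>\<open>G\<close> does not read the eliminated coordinates, so any value can be
    filled in for them.\<close>
  define g where "g p = G (case_sum (\<lambda>_. 0) p)" for p
  have "quad_form K g" unfolding g_def
    by (rule quad_form_comp[OF G(1), where L = "\<lambda>x p. case_sum (\<lambda>_. 0) p x"])
      (use K in \<open>auto intro!: lin_form_coord\<close>)
  moreover have "F z - c * (\<Sum>k\<in>K. (L k z - p k)\<^sup>2) \<le> g p" for z p
  proof -
    have "G (case_sum z p) = g p" unfolding g_def by (rule quad_form_cong[OF G(1)]) auto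
    then show ?thesis using G(2)[of "case_sum z p"] unfolding q_def by simp
  qed
  moreover have "\<exists>z. F z - c * (\<Sum>k\<in>K. (L k z - p k)\<^sup>2) = g p" for p
  proof -
    obtain h where h: "\<forall>b. b \<notin> ?A \<longrightarrow> h b = case_sum (\<lambda>_. 0) p b" "q h = g p"
      using G(3) unfolding g_def by blast
    have "h (Inr k) = p k" for k using h(1) by auto
    then show ?thesis using h(2) unfolding q_def by auto
  qed
  ultimately show ?thesis by blast
qed

text \<open>A longest simple path inside \<open>N\<close> starts at a leaf. If its first vertex had
  two neighbours in \<open>N\<close>, both would lie on the path by maximality, and the edge from
  the farther one back to the first vertex would close a cycle. The vertex found may be
  isolated.\<close>

lemma forest_has_leaf:
  assumes "finite N" "N \<noteq> {}" "sym E" "irrefl E"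
    and acyc: "\<not> (\<exists>c. length c \<ge> 3 \<and> distinct c \<and> (\<forall>k < length c. (c ! k, c ! (Suc k mod length c)) \<in> E))"
  shows "\<exists>i\<in>N. \<forall>j\<in>N. \<forall>k\<in>N. (i, j) \<in> E \<longrightarrow> (i, k) \<in> E \<longrightarrow> j = k"
proof (rule ccontr)
  assume two: "\<not> ?thesis"
  let ?P = "\<lambda>c. c \<noteq> [] \<and> distinct c \<and> set c \<subseteq> N \<and> (\<forall>k. Suc k < length c \<longrightarrow> (c ! k, c ! Suc k) \<in> E)"
  obtain v where "v \<in> N" using assms(2) by blast
  then have "?P [v]" by simp
  moreover have "\<forall>c. ?P c \<longrightarrow> length c < Suc (card N)"
  proof (intro allI impI)
    fix c assume "?P c"
    then show "length c < Suc (card N)"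
      using distinct_card[of c] card_mono[OF assms(1), of "set c"] by simp
  qed
  ultimately have "\<exists>c. ?P c \<and> (\<forall>d. ?P d \<longrightarrow> length d \<le> length c)"
    by (rule ex_has_greatest_nat)
  then obtain c where c: "?P c" and max: "\<And>d. ?P d \<Longrightarrow> length d \<le> length c" by blast
  have c0: "c ! 0 \<in> N" using c by (metis length_greater_0_conv nth_mem subsetD)
  have ext: "\<exists>m < length c. m \<noteq> 0 \<and> c ! m = a" if "a \<in> N" "(c ! 0, a) \<in> E" for a
  proof -
    have "a \<in> set c"
    proof (rule ccontr)
      assume "a \<notin> set c"
      moreover have "((a # c) ! k, (a # c) ! Suc k) \<in> E" if "Suc k < length (a # c)" for k
        using c \<open>(c ! 0, a) \<in> E\<close> \<open>sym E\<close> that by (cases k) (simp_all add: sym_def)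
      ultimately have "?P (a # c)" using c \<open>a \<in> N\<close> by simp
      from max[OF this] show False by simp
    qed
    moreover have "a \<noteq> c ! 0" using that \<open>irrefl E\<close> by (auto simp: irrefl_def)
    ultimately show ?thesis unfolding in_set_conv_nth by metis
  qed
  obtain a b where ab: "a \<in> N" "b \<in> N" "(c ! 0, a) \<in> E" "(c ! 0, b) \<in> E" "a \<noteq> b"
    using two c0 by blast
  obtain p q where pq: "p < length c" "p \<noteq> 0" "c ! p = a" "q < length c" "q \<noteq> 0" "c ! q = b"
    using ext ab by meson
  define m where "m = max p q"
  \<comment> \<open>Both positions are nonzero and they are distinct, so the larger is at least 2
    and the cycle has at least three vertices.\<close>
  have "p \<noteq> q" using ab(5) pq by blast
  then have m: "m < length c" "2 \<le> m" "(c ! m, c ! 0) \<in> E"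
    using pq ab \<open>sym E\<close> unfolding m_def by (auto simp: max_def sym_def)
  have "(take (Suc m) c ! k, take (Suc m) c ! (Suc k mod Suc m)) \<in> E" if "k < Suc m" for k
  proof (cases "k = m")
    case False
    then show ?thesis using that m(1) c by simp
  qed (use m in simp)
  moreover have "length (take (Suc m) c) = Suc m" "distinct (take (Suc m) c)" using m c by auto
  ultimately show False using acyc m(2) by (metis Suc_le_mono eval_nat_numeral(3))
qed

text \<open>Induction on the number of vertices, with \<open>F\<close> arbitrary because removing a
  leaf changes the form of its neighbour. The systems are abstracted away: \<open>I i\<close> holds
  the coordinates of vertex \<open>i\<close>, \<open>K i j\<close> indexes the signals on an edge in
  both directions, and \<open>L i j k\<close> is signal \<open>k\<close> as vertex \<open>i\<close>
  sees it. The conclusion is non-strict because the maxima are attained.\<close>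

lemma forest_supplies:
  fixes F :: "'v \<Rightarrow> ('a \<Rightarrow> real) \<Rightarrow> real" and L :: "'v \<Rightarrow> 'v \<Rightarrow> 'k \<Rightarrow> ('a \<Rightarrow> real) \<Rightarrow> real"
  assumes E: "sym E" "irrefl E"
    and acyc: "\<not> (\<exists>c. length c \<ge> 3 \<and> distinct c \<and> (\<forall>k < length c. (c ! k, c ! (Suc k mod length c)) \<in> E))"
    and K: "\<And>i j. K i j = K j i" "\<And>i j. (i, j) \<in> E \<Longrightarrow> finite (K i j)"
  shows "\<lbrakk>finite N; \<And>i. i \<in> N \<Longrightarrow> finite (I i); \<And>i. i \<in> N \<Longrightarrow> quad_form (I i) (F i);
    \<And>i j. i \<in> N \<Longrightarrow> j \<in> N \<Longrightarrow> i \<noteq> j \<Longrightarrow> I i \<inter> I j = {};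
    \<And>i j k. i \<in> N \<Longrightarrow> j \<in> N \<Longrightarrow> (i, j) \<in> E \<Longrightarrow> k \<in> K i j \<Longrightarrow> lin_form (I i) (L i j k);
    \<And>f. \<exists>i\<in>N. \<exists>a\<in>I i. f a \<noteq> 0 \<Longrightarrow>
      (\<Sum>i\<in>N. F i f) - c * (\<Sum>i\<in>N. \<Sum>j\<in>N. if (i, j) \<in> E then \<Sum>k\<in>K i j. (L i j k f - L j i k f)\<^sup>2 else 0) < 0\<rbrakk>
  \<Longrightarrow> \<exists>s. (\<forall>i\<in>N. \<forall>j\<in>N. (i, j) \<in> E \<longrightarrow> quad_form (K i j) (s i j) \<and> (\<forall>p. s i j p + s j i p = 0)) \<and>
    (\<forall>i\<in>N. \<forall>f. F i f \<le> (\<Sum>j\<in>N. if (i, j) \<in> E then s i j (\<lambda>k. L i j k f) else 0))"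
proof (induction "card N" arbitrary: N F)
  case 0
  then show ?case by simp
next
  case (Suc n)
  note N = Suc.prems(1) and I = Suc.prems(2) and F = Suc.prems(3) and disj = Suc.prems(4)
    and L = Suc.prems(5) and neg = Suc.prems(6)
  define t where "t i j f = (if (i, j) \<in> E then \<Sum>k\<in>K i j. (L i j k f - L j i k f)\<^sup>2 else 0)" for i j f
  have t_sym: "t i j f = t j i f" for i j f
    unfolding t_def using \<open>sym E\<close> K(1)[of i j] by (auto simp: sym_def power2_commute intro!: sum.cong)
  have t_cong: "t x y f = t x y g" if "x \<in> N" "y \<in> N" "\<And>a. a \<in> I x \<union> I y \<Longrightarrow> f a = g a" for x y and f g :: "'a \<Rightarrow> real"
  proof (cases "(x, y) \<in> E")
    case True
    then have "(y, x) \<in> E" using E(1) by (auto simp: sym_def)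
    have "L x y k f = L x y k g" "L y x k f = L y x k g" if "k \<in> K x y" for k
      using that lin_form_cong[OF L[of x y k], of f g] lin_form_cong[OF L[of y x k], of f g]
        True \<open>(y, x) \<in> E\<close> \<open>x \<in> N\<close> \<open>y \<in> N\<close> \<open>\<And>a. a \<in> I x \<union> I y \<Longrightarrow> f a = g a\<close> K(1)[of x y] by auto
    then show ?thesis unfolding t_def by simp
  qed (simp add: t_def)
  have t_0: "t x y f = 0" if "x \<in> N" "y \<in> N" "\<And>a. a \<in> I x \<union> I y \<Longrightarrow> f a = 0" for x y and f :: "'a \<Rightarrow> real"
  proof -
    have "t x y f = t x y (\<lambda>_. 0)" using that by (intro t_cong) auto
    also have "\<dots> = 0" unfolding t_def using that(1,2) E(1) K(1)[of x y]
      by (auto simp: sym_def lin_form_zero[OF L] intro!: sum.neutral)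
    finally show ?thesis .
  qed
  obtain i where i: "i \<in> N" and leaf: "\<And>j k. j \<in> N \<Longrightarrow> k \<in> N \<Longrightarrow> (i, j) \<in> E \<Longrightarrow> (i, k) \<in> E \<Longrightarrow> j = k"
    using forest_has_leaf[OF N _ E acyc] Suc.hyps(2) by fastforce
  define N' where "N' = N - {i}"
  have N': "finite N'" "N' \<subseteq> N" "i \<notin> N'" "N = insert i N'" "card N' = n"
    using N i Suc.hyps(2) by (auto simp: N'_def)
  have sub: "x \<in> N" if "x \<in> N'" for x using that N'(2) by blast
  have tii: "t i i f = 0" for f unfolding t_def using E(2) by (auto simp: irrefl_def)
  define R where "R f = (\<Sum>x\<in>N'. \<Sum>y\<in>N'. t x y f)" for f :: "'a \<Rightarrow> real"
  \<comment> \<open>The double sum runs over ordered pairs, so every edge at the leaf is counted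
    twice; hence the factor 2.\<close>
  have split: "(\<Sum>x\<in>N. F x f) - c * (\<Sum>x\<in>N. \<Sum>y\<in>N. t x y f)
      = F i f + (\<Sum>x\<in>N'. F x f) - c * (2 * (\<Sum>y\<in>N'. t i y f) + R f)" for f :: "'a \<Rightarrow> real"
  proof -
    have "(\<Sum>x\<in>N'. t x i f) = (\<Sum>y\<in>N'. t i y f)" by (intro sum.cong refl t_sym)
    then show ?thesis unfolding N'(4) R_def using N'(1,3) tii by (simp add: sum.distrib)
  qed
  have neg: "F i f + (\<Sum>x\<in>N'. F x f) - c * (2 * (\<Sum>y\<in>N'. t i y f) + R f) < 0"
    if "\<exists>x\<in>N. \<exists>a\<in>I x. f a \<noteq> 0" for f :: "'a \<Rightarrow> real"
    using neg[OF that, folded t_def] unfolding split .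
  have R_cong: "R f = R g" "(\<Sum>x\<in>N'. F x f) = (\<Sum>x\<in>N'. F x g)"
    if "\<And>a. a \<notin> I i \<Longrightarrow> f a = g a" for f g :: "'a \<Rightarrow> real"
  proof -
    have *: "f a = g a" if "x \<in> N'" "a \<in> I x" for x a
      using that disj[of x i] N' \<open>\<And>a. a \<notin> I i \<Longrightarrow> f a = g a\<close> by auto
    show "(\<Sum>x\<in>N'. F x f) = (\<Sum>x\<in>N'. F x g)"
      using * N'(2) by (intro sum.cong refl quad_form_cong[OF F]) auto
    show "R f = R g" unfolding R_def using * N'(2) by (intro sum.cong refl t_cong) auto
  qed
  have R_0: "R (\<lambda>a. if a \<in> I i then z a else 0) = 0"
    "(\<Sum>x\<in>N'. F x (\<lambda>a. if a \<in> I i then z a else 0)) = 0" for z :: "'a \<Rightarrow> real"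
  proof -
    have "(\<Sum>x\<in>N'. F x (\<lambda>_. 0)) = 0" "R (\<lambda>_. 0) = 0"
      unfolding R_def using N'(2) by (auto intro!: sum.neutral quad_form_zero[OF F] t_0)
    then show "R (\<lambda>a. if a \<in> I i then z a else 0) = 0"
      "(\<Sum>x\<in>N'. F x (\<lambda>a. if a \<in> I i then z a else 0)) = 0"
      using R_cong[of "\<lambda>a. if a \<in> I i then z a else 0" "\<lambda>_. 0"] by auto
  qed
  have Fi: "F i (\<lambda>a. if a \<in> I i then z a else g a) = F i z" for z g
    by (rule quad_form_cong[OF F[OF i]]) simp
  note IH = Suc.hyps(1)[OF N'(5)[symmetric] N'(1)]
  show ?case
  proof (cases "\<exists>j\<in>N. (i, j) \<in> E")
    case False
    then have iso: "(i, x) \<notin> E" "(x, i) \<notin> E" if "x \<in> N" for x using that E(1) by (auto simp: sym_def)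
    have ti: "(\<Sum>y\<in>N'. t i y f) = 0" for f using iso N'(2) by (auto simp: t_def intro!: sum.neutral)
    have "\<exists>s. (\<forall>x\<in>N'. \<forall>y\<in>N'. (x, y) \<in> E \<longrightarrow> quad_form (K x y) (s x y) \<and> (\<forall>p. s x y p + s y x p = 0)) \<and>
      (\<forall>x\<in>N'. \<forall>f. F x f \<le> (\<Sum>y\<in>N'. if (x, y) \<in> E then s x y (\<lambda>k. L x y k f) else 0))"
    proof (rule IH)
      fix f :: "'a \<Rightarrow> real" assume f: "\<exists>x\<in>N'. \<exists>a\<in>I x. f a \<noteq> 0"
      \<comment> \<open>Setting the coordinates of the isolated vertex to 0 removes
        \<open>F i\<close> and leaves the rest unchanged.\<close>
      let ?h = "\<lambda>a. if a \<in> I i then 0 else f a"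
      from f obtain x a where xa: "x \<in> N'" "a \<in> I x" "f a \<noteq> 0" by blast
      then have "a \<notin> I i" using disj[of x i] i N' by auto
      then have "\<exists>x\<in>N. \<exists>a\<in>I x. ?h a \<noteq> 0" using xa N'(2) by auto
      from neg[OF this] have "(\<Sum>x\<in>N'. F x ?h) - c * R ?h < 0"
        unfolding ti Fi using quad_form_zero[OF F[OF i], of "\<lambda>_. 0"] by simp
      then have "(\<Sum>x\<in>N'. F x f) - c * R f < 0" using R_cong[of ?h f] by simp
      then show "(\<Sum>x\<in>N'. F x f) - c * (\<Sum>i\<in>N'. \<Sum>j\<in>N'. if (i, j) \<in> E then \<Sum>k\<in>K i j. (L i j k f - L j i k f)\<^sup>2 else 0) < 0"
        unfolding R_def t_def .
    qed (use sub in \<open>simp_all add: I F disj L\<close>)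
    then obtain s where s: "\<And>x y. x\<in>N' \<Longrightarrow> y\<in>N' \<Longrightarrow> (x, y) \<in> E \<Longrightarrow> quad_form (K x y) (s x y) \<and> (\<forall>p. s x y p + s y x p = 0)"
      "\<And>x f. x\<in>N' \<Longrightarrow> F x f \<le> (\<Sum>y\<in>N'. if (x, y) \<in> E then s x y (\<lambda>k. L x y k f) else 0)" by blast
    \<comment> \<open>An isolated vertex has an empty sum of supplies, so its own form must be
      nonpositive.\<close>
    have Fi0: "F i f \<le> 0" for f :: "'a \<Rightarrow> real"
    proof (cases "\<exists>a\<in>I i. f a \<noteq> 0")
      case True
      then have "\<exists>x\<in>N. \<exists>a\<in>I x. (\<lambda>a. if a \<in> I i then f a else 0) a \<noteq> 0" using i by auto
      from neg[OF this] show ?thesis unfolding ti Fi R_0 by simp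
    next
      case False
      then show ?thesis using quad_form_zero[OF F[OF i]] by simp
    qed
    show ?thesis
    proof (intro exI[of _ s] conjI ballI impI allI)
      fix x y assume "x \<in> N" "y \<in> N" "(x, y) \<in> E"
      then have "x \<in> N'" "y \<in> N'" using iso unfolding N'(4) by auto
      then show "quad_form (K x y) (s x y)" "s x y p + s y x p = 0" for p
        using s(1) \<open>(x, y) \<in> E\<close> by auto
    next
      fix x and f :: "'a \<Rightarrow> real" assume x: "x \<in> N"
      show "F x f \<le> (\<Sum>y\<in>N. if (x, y) \<in> E then s x y (\<lambda>k. L x y k f) else 0)"
      proof (cases "x = i")
        case True
        then show ?thesis using Fi0 iso by simp
      next
        case False
        then have "x \<in> N'" using x N' by auto
        then show ?thesis using s(2)[of x f] iso x N'(1,3) unfolding N'(4) by simp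
      qed
    qed
  next
    case True
    then obtain j where j: "j \<in> N" "(i, j) \<in> E" by blast
    have ji: "(j, i) \<in> E" "i \<noteq> j" "j \<in> N'" using j E N'(4) by (auto simp: sym_def irrefl_def)
    have only: "(i, x) \<in> E \<longleftrightarrow> x = j" "(x, i) \<in> E \<longleftrightarrow> x = j" if "x \<in> N" for x
      using that leaf[of x j] j ji(1) E(1) by (auto simp: sym_def)
    have ti: "(\<Sum>y\<in>N'. t i y f) = (\<Sum>k\<in>K i j. (L i j k f - L j i k f)\<^sup>2)" for f :: "'a \<Rightarrow> real"
    proof -
      have "(\<Sum>y\<in>N'. t i y f) = (\<Sum>y\<in>N'. if y = j then t i j f else 0)"
        using only N'(2) by (intro sum.cong refl) (auto simp: t_def)
      then show ?thesis using ji(3) N'(1) j by (simp add: t_def)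
    qed
    have Lij: "lin_form (I i) (L i j k)" "lin_form (I j) (L j i k)" if "k \<in> K i j" for k
      using that L i j ji K(1)[of i j] by auto
    have Ij: "a \<notin> I i" if "a \<in> I j" for a using that disj[OF i j(1) ji(2)] by auto
    have "\<exists>g. quad_form (K i j) g \<and> (\<forall>z p. F i z - (2 * c) * (\<Sum>k\<in>K i j. (L i j k z - p k)\<^sup>2) \<le> g p) \<and>
      (\<forall>p. \<exists>z. F i z - (2 * c) * (\<Sum>k\<in>K i j. (L i j k z - p k)\<^sup>2) = g p)"
    proof (rule leaf_supply[OF I[OF i] K(2)[OF j(2)] F[OF i] Lij(1)])
      fix z :: "'a \<Rightarrow> real" assume "\<exists>a\<in>I i. z a \<noteq> 0"
      \<comment> \<open>With all other vertices at 0, the signals seen by the neighbour are 0, and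
        only the form of the leaf and its penalty remain.\<close>
      let ?h = "\<lambda>a. if a \<in> I i then z a else 0"
      have "\<exists>x\<in>N. \<exists>a\<in>I x. ?h a \<noteq> 0" using \<open>\<exists>a\<in>I i. z a \<noteq> 0\<close> i by auto
      from neg[OF this] have "F i z - 2 * c * (\<Sum>k\<in>K i j. (L i j k ?h - L j i k ?h)\<^sup>2) < 0"
        unfolding ti Fi R_0 by simp
      moreover have "L i j k ?h = L i j k z" "L j i k ?h = 0" if "k \<in> K i j" for k
        using lin_form_cong[OF Lij(1)[OF that], of ?h z] lin_form_zero[OF Lij(2)[OF that], of ?h] Ij by auto
      ultimately show "F i z - 2 * c * (\<Sum>k\<in>K i j. (L i j k z)\<^sup>2) < 0" by simp
    qed
    then obtain g where g: "quad_form (K i j) g"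
      "\<And>z p. F i z - (2 * c) * (\<Sum>k\<in>K i j. (L i j k z - p k)\<^sup>2) \<le> g p"
      "\<And>p. \<exists>z. F i z - (2 * c) * (\<Sum>k\<in>K i j. (L i j k z - p k)\<^sup>2) = g p" by blast
    \<comment> \<open>The neighbour takes over the largest contribution the removed leaf can make,
      given the signals as the neighbour sees them.\<close>
    define F' where "F' = F(j := \<lambda>f. F j f + g (\<lambda>k. L j i k f))"
    have F'sum: "(\<Sum>x\<in>N'. F' x f) = (\<Sum>x\<in>N'. F x f) + g (\<lambda>k. L j i k f)" for f :: "'a \<Rightarrow> real"
      using ji(3) N'(1) unfolding F'_def by (simp add: sum.remove)
    have "\<exists>s. (\<forall>x\<in>N'. \<forall>y\<in>N'. (x, y) \<in> E \<longrightarrow> quad_form (K x y) (s x y) \<and> (\<forall>p. s x y p + s y x p = 0)) \<and>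
      (\<forall>x\<in>N'. \<forall>f. F' x f \<le> (\<Sum>y\<in>N'. if (x, y) \<in> E then s x y (\<lambda>k. L x y k f) else 0))"
    proof (rule IH)
      show "quad_form (I x) (F' x)" if "x \<in> N'" for x
        using that N'(2) unfolding F'_def by (auto intro!: F quad_form_add quad_form_comp[OF g(1)] Lij)
      fix f :: "'a \<Rightarrow> real" assume f: "\<exists>x\<in>N'. \<exists>a\<in>I x. f a \<noteq> 0"
      obtain z where z: "F i z - (2 * c) * (\<Sum>k\<in>K i j. (L i j k z - L j i k f)\<^sup>2) = g (\<lambda>k. L j i k f)"
        using g(3)[of "\<lambda>k. L j i k f"] by blast
      \<comment> \<open>The maximiser \<open>z\<close> for the signals prescribed by
        \<open>f\<close> is spliced in at the leaf, so the old penalised form at \<open>?h\<close>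
        equals the new one at \<open>f\<close>.\<close>
      let ?h = "\<lambda>a. if a \<in> I i then z a else f a"
      from f obtain x a where xa: "x \<in> N'" "a \<in> I x" "f a \<noteq> 0" by blast
      then have "a \<notin> I i" using disj[of x i] i N' by auto
      then have "\<exists>x\<in>N. \<exists>a\<in>I x. ?h a \<noteq> 0" using xa N'(2) by auto
      from neg[OF this] have
        "F i z + (\<Sum>x\<in>N'. F x f) - c * (2 * (\<Sum>k\<in>K i j. (L i j k ?h - L j i k ?h)\<^sup>2) + R f) < 0"
        unfolding ti Fi using R_cong[of ?h f] by simp
      moreover have "L i j k ?h = L i j k z" "L j i k ?h = L j i k f" if "k \<in> K i j" for k
        using lin_form_cong[OF Lij(1)[OF that], of ?h z] lin_form_cong[OF Lij(2)[OF that], of ?h f] Ij by auto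
      ultimately have "(\<Sum>x\<in>N'. F' x f) - c * R f < 0"
        unfolding F'sum z[symmetric] by (simp add: algebra_simps)
      then show "(\<Sum>x\<in>N'. F' x f) - c * (\<Sum>i\<in>N'. \<Sum>j\<in>N'. if (i, j) \<in> E then \<Sum>k\<in>K i j. (L i j k f - L j i k f)\<^sup>2 else 0) < 0"
        unfolding R_def t_def .
    qed (use sub in \<open>simp_all add: I disj L\<close>)
    then obtain s where s: "\<And>x y. x\<in>N' \<Longrightarrow> y\<in>N' \<Longrightarrow> (x, y) \<in> E \<Longrightarrow> quad_form (K x y) (s x y) \<and> (\<forall>p. s x y p + s y x p = 0)"
      "\<And>x f. x\<in>N' \<Longrightarrow> F' x f \<le> (\<Sum>y\<in>N'. if (x, y) \<in> E then s x y (\<lambda>k. L x y k f) else 0)" by blast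
    define s' where "s' x y = (if x = i then g else if y = i then \<lambda>p. - g p else s x y)" for x y
    show ?thesis
    proof (intro exI[of _ s'] conjI ballI impI allI)
      fix x y assume xy: "x \<in> N" "y \<in> N" "(x, y) \<in> E"
      consider "x = i" "y = j" | "x = j" "y = i" | "x \<in> N'" "y \<in> N'"
        using xy only N'(4) by blast
      then have "quad_form (K x y) (s' x y) \<and> (\<forall>p. s' x y p + s' y x p = 0)"
        by cases (use g(1) quad_form_scale[OF g(1), of "-1"] K(1)[of i j] ji s(1) xy N'(3) in \<open>auto simp: s'_def\<close>)
      then show "quad_form (K x y) (s' x y)" "s' x y p + s' y x p = 0" for p by auto
    next
      fix x and f :: "'a \<Rightarrow> real" assume x: "x \<in> N"
      consider "x = i" | "x = j" | "x \<in> N'" "x \<noteq> j" using x N'(4) by blast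
      then show "F x f \<le> (\<Sum>y\<in>N. if (x, y) \<in> E then s' x y (\<lambda>k. L x y k f) else 0)"
      proof cases
        case 1
        have "(\<Sum>y\<in>N. if (i, y) \<in> E then s' i y (\<lambda>k. L i y k f) else 0)
          = (\<Sum>y\<in>N. if y = j then g (\<lambda>k. L i j k f) else 0)"
          using only by (intro sum.cong refl) (auto simp: s'_def)
        also have "\<dots> = g (\<lambda>k. L i j k f)" using j N by simp
        \<comment> \<open>With \<open>p\<close> equal to the signals seen by the leaf itself, the
          penalty vanishes.\<close>
        finally show ?thesis unfolding 1 using g(2)[of f "\<lambda>k. L i j k f"] by simp
      next
        case 2
        have "(\<Sum>y\<in>N. if (j, y) \<in> E then s' j y (\<lambda>k. L j y k f) else 0)
          = - g (\<lambda>k. L j i k f) + (\<Sum>y\<in>N'. if (j, y) \<in> E then s j y (\<lambda>k. L j y k f) else 0)"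
          unfolding N'(4) using N'(1,3) ji by (auto simp: s'_def intro!: sum.cong)
        \<comment> \<open>The term \<open>g\<close> contained in \<open>F' j\<close> moves to the
          right, where it is the supply \<open>- g\<close> of the edge to the leaf.\<close>
        then show ?thesis using s(2)[OF ji(3), of f] unfolding 2 F'_def by simp
      next
        case 3
        have "(\<Sum>y\<in>N. if (x, y) \<in> E then s' x y (\<lambda>k. L x y k f) else 0)
          = (\<Sum>y\<in>N'. if (x, y) \<in> E then s x y (\<lambda>k. L x y k f) else 0)"
          unfolding N'(4) using N'(1,3) 3 only(2)[OF x] by (auto simp: s'_def intro!: sum.cong)
        then show ?thesis using s(2)[OF 3(1), of f] 3 unfolding F'_def by simp
      qed
    qed
  qed
qed

section \<open>Linear maps and stacked vectors\<close>

lemma mult_mat_vec_index_sum: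
  assumes "A \<in> carrier_mat m n" "x \<in> carrier_vec n" "k < m"
  shows "(A *\<^sub>v x) $ k = (\<Sum>l<n. A $$ (k, l) * x $ l)"
  using assms by (auto simp: scalar_prod_def atLeast0LessThan intro!: sum.cong)

lemma scalar_prod_sum:
  assumes "x \<in> carrier_vec n" shows "y \<bullet> x = (\<Sum>l<n. y $ l * x $ l)"
  using assms by (auto simp: scalar_prod_def atLeast0LessThan)

text \<open>The columns of the matrix are the images of the unit vectors. The induction runs over
  the truncations of \<open>y\<close> to its first \<open>k\<close> entries, each step adding a
  multiple of one unit vector; the combination with both coefficients 0 gives the value at the zero
  vector.\<close>

lemma linear_imp_mult_mat_vec:
  fixes \<phi> :: "real vec \<Rightarrow> real vec"
  assumes \<phi>: "\<And>y. y \<in> carrier_vec n \<Longrightarrow> \<phi> y \<in> carrier_vec m"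
    and lin: "\<And>a b y z. y \<in> carrier_vec n \<Longrightarrow> z \<in> carrier_vec n \<Longrightarrow>
      \<phi> (a \<cdot>\<^sub>v y + b \<cdot>\<^sub>v z) = a \<cdot>\<^sub>v \<phi> y + b \<cdot>\<^sub>v \<phi> z"
  shows "\<exists>A \<in> carrier_mat m n. \<forall>y \<in> carrier_vec n. \<phi> y = A *\<^sub>v y"
proof
  let ?A = "mat m n (\<lambda>(r, c). \<phi> (unit_vec n c) $ r)"
  show A: "?A \<in> carrier_mat m n" by simp
  show "\<forall>y \<in> carrier_vec n. \<phi> y = ?A *\<^sub>v y"
  proof
    fix y :: "real vec" assume y: "y \<in> carrier_vec n"
    let ?t = "\<lambda>k. vec n (\<lambda>i. if i < k then y $ i else 0)"
    have step: "\<phi> (?t k) $ r = (\<Sum>c<k. \<phi> (unit_vec n c) $ r * y $ c)" if "k \<le> n" "r < m" for k r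
      using that(1)
    proof (induction k)
      case 0
      have "\<phi> (?t 0) = \<phi> (0 \<cdot>\<^sub>v ?t 0 + 0 \<cdot>\<^sub>v ?t 0)" by (rule arg_cong[of _ _ \<phi>]) auto
      also have "\<dots> = 0 \<cdot>\<^sub>v \<phi> (?t 0) + 0 \<cdot>\<^sub>v \<phi> (?t 0)" by (rule lin) auto
      finally have "\<phi> (?t 0) $ r = (0 \<cdot>\<^sub>v \<phi> (?t 0) + 0 \<cdot>\<^sub>v \<phi> (?t 0)) $ r" by (rule arg_cong)
      also have "\<dots> = 0" using \<phi>[of "?t 0"] that(2) by auto
      finally show ?case by simp
    next
      case (Suc k)
      have "\<phi> (?t (Suc k)) = \<phi> (1 \<cdot>\<^sub>v ?t k + (y $ k) \<cdot>\<^sub>v unit_vec n k)"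
        using Suc.prems by (intro arg_cong[of _ _ \<phi>] eq_vecI) (auto simp: unit_vec_def less_Suc_eq)
      also have "\<dots> = 1 \<cdot>\<^sub>v \<phi> (?t k) + (y $ k) \<cdot>\<^sub>v \<phi> (unit_vec n k)" by (rule lin) auto
      finally show ?case using Suc \<phi>[of "?t k"] \<phi>[of "unit_vec n k"] that(2) by auto
    qed
    show "\<phi> y = ?A *\<^sub>v y"
    proof (rule eq_vecI)
      have "?t n = y" using y by (intro eq_vecI) auto
      fix r assume "r < dim_vec (?A *\<^sub>v y)"
      then have r: "r < m" by simp
      show "\<phi> y $ r = (?A *\<^sub>v y) $ r"
        unfolding mult_mat_vec_index_sum[OF A y r] using step[OF le_refl r] \<open>?t n = y\<close> r by simp
    qed (use \<phi>[OF y] in simp)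
  qed
qed

section \<open>Stacked vectors and block diagonal matrices\<close>

lemma append_vec_vNil_right: "v @\<^sub>v vNil = v"
  by (rule eq_vecI) auto

lemma append_vec_assoc: "(u @\<^sub>v v) @\<^sub>v w = u @\<^sub>v (v @\<^sub>v w)"
  by (rule eq_vecI) auto

lemma foldr_append_vec: "foldr (@\<^sub>v) xs a = foldr (@\<^sub>v) xs vNil @\<^sub>v a"
  by (induction xs) (auto simp: append_vec_assoc)

text \<open>The number of blocks is an explicit argument so that inductions can peel off the last
  block, as \<open>diag_block_mat_last\<close> does for matrices; the \<open>foldr\<close> in
  \<open>col_vec\<close> peels off the first.\<close>

definition stack :: "(nat \<Rightarrow> real vec) \<Rightarrow> nat \<Rightarrow> real vec" where
  "stack x n = col_vec (map x [0..<n])"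

lemma stack_0: "stack x 0 = vNil"
  by (simp add: stack_def col_vec_def)

lemma stack_Suc: "stack x (Suc n) = stack x n @\<^sub>v x n"
proof -
  have "stack x (Suc n) = foldr (@\<^sub>v) (map x [0..<n]) (x n)"
    by (simp add: stack_def col_vec_def append_vec_vNil_right)
  also have "\<dots> = stack x n @\<^sub>v x n"
    unfolding stack_def col_vec_def by (rule foldr_append_vec)
  finally show ?thesis .
qed

lemma stack_carrier:
  "(\<And>i. i < n \<Longrightarrow> x i \<in> carrier_vec (d i)) \<Longrightarrow> stack x n \<in> carrier_vec (\<Sum>i<n. d i)"
  by (induction n) (auto simp: stack_0 stack_Suc)

lemma stack_scalar_prod:
  "(\<And>i. i < n \<Longrightarrow> x i \<in> carrier_vec (d i)) \<Longrightarrow> (\<And>i. i < n \<Longrightarrow> y i \<in> carrier_vec (d i)) \<Longrightarrow>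
    stack x n \<bullet> stack y n = (\<Sum>i<n. x i \<bullet> y i)"
proof (induction n)
  case 0 then show ?case by (simp add: stack_0 scalar_prod_def)
next
  case (Suc n)
  have "stack x (Suc n) \<bullet> stack y (Suc n) = stack x n \<bullet> stack y n + x n \<bullet> y n"
    unfolding stack_Suc using Suc.prems
    by (intro scalar_prod_append[of _ "\<Sum>i<n. d i" _ "d n"] stack_carrier) auto
  then show ?case using Suc by simp
qed

lemma stack_inj:
  "(\<And>i. i < n \<Longrightarrow> x i \<in> carrier_vec (d i)) \<Longrightarrow> (\<And>i. i < n \<Longrightarrow> y i \<in> carrier_vec (d i)) \<Longrightarrow>
    stack x n = stack y n \<Longrightarrow> i < n \<Longrightarrow> x i = y i"
proof (induction n)
  case (Suc n)
  have "stack x n = stack y n \<and> x n = y n"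
    using Suc.prems(3) unfolding stack_Suc
    by (subst (asm) append_vec_eq[OF stack_carrier[of n _ d] stack_carrier[of n _ d]]) (use Suc.prems in auto)
  then show ?case using Suc by (auto simp: less_Suc_eq)
qed simp

lemma stack_lincomb:
  "(\<And>i. i < n \<Longrightarrow> x i \<in> carrier_vec (d i)) \<Longrightarrow> (\<And>i. i < n \<Longrightarrow> y i \<in> carrier_vec (d i)) \<Longrightarrow>
    stack (\<lambda>i. a \<cdot>\<^sub>v x i + b \<cdot>\<^sub>v y i) n = a \<cdot>\<^sub>v stack x n + b \<cdot>\<^sub>v stack y n"
proof (induction n)
  case (Suc n)
  have "stack x n \<in> carrier_vec (\<Sum>i<n. d i)" "stack y n \<in> carrier_vec (\<Sum>i<n. d i)"
    "x n \<in> carrier_vec (d n)" "y n \<in> carrier_vec (d n)" using Suc.prems by (auto intro!: stack_carrier)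
  moreover have "stack (\<lambda>i. a \<cdot>\<^sub>v x i + b \<cdot>\<^sub>v y i) n = a \<cdot>\<^sub>v stack x n + b \<cdot>\<^sub>v stack y n" using Suc by simp
  ultimately show ?case unfolding stack_Suc by (intro eq_vecI) auto
qed (auto simp: stack_0)

text \<open>The inverse of \<open>stack\<close> on vectors of the right total length; the sum is the
  offset at which block \<open>i\<close> begins.\<close>

definition unstack :: "(nat \<Rightarrow> nat) \<Rightarrow> real vec \<Rightarrow> nat \<Rightarrow> real vec" where
  "unstack d y i = vec (d i) (\<lambda>k. y $ ((\<Sum>l<i. d l) + k))"

lemma unstack_carrier [simp]: "unstack d y i \<in> carrier_vec (d i)"
  by (simp add: unstack_def)

lemma stack_unstack_index:
  "k < (\<Sum>i<n. d i) \<Longrightarrow> stack (unstack d y) n $ k = y $ k"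
proof (induction n)
  case (Suc n)
  have "stack (unstack d y) n \<in> carrier_vec (\<Sum>i<n. d i)" by (rule stack_carrier) simp
  moreover have "k < (\<Sum>i<n. d i) + d n" using Suc.prems by simp
  ultimately show ?case unfolding stack_Suc using Suc.IH by (auto simp: unstack_def[of d y n])
qed simp

lemma stack_unstack: "y \<in> carrier_vec (\<Sum>i<n. d i) \<Longrightarrow> stack (unstack d y) n = y"
  using carrier_vecD[OF stack_carrier[of n "unstack d y" d]] by (intro eq_vecI) (simp_all add: stack_unstack_index)

lemma unstack_lincomb:
  assumes "y \<in> carrier_vec (\<Sum>i<n. d i)" "z \<in> carrier_vec (\<Sum>i<n. d i)" "i < n"
  shows "unstack d (a \<cdot>\<^sub>v y + b \<cdot>\<^sub>v z) i = a \<cdot>\<^sub>v unstack d y i + b \<cdot>\<^sub>v unstack d z i"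
proof -
  have "(\<Sum>l<i. d l) + d i \<le> (\<Sum>i<n. d i)"
    using sum_mono2[of "{..<n}" "{..<Suc i}" d] assms(3) by (simp add: less_Suc_eq_le)
  then show ?thesis using assms(1,2) by (intro eq_vecI) (auto simp: unstack_def)
qed

lemma unstack_stack:
  assumes "\<And>i. i < n \<Longrightarrow> x i \<in> carrier_vec (d i)" "i < n" shows "unstack d (stack x n) i = x i"
  by (rule stack_inj[of n _ d]) (simp_all add: assms stack_unstack stack_carrier)

lemma diag_block_mat_carrier:
  "(\<And>i. i < n \<Longrightarrow> P i \<in> carrier_mat (d i) (d i)) \<Longrightarrow>
    diag_block_mat (map P [0..<n]) \<in> carrier_mat (\<Sum>i<n. d i) (\<Sum>i<n. d i)"
  by (induction n) (auto simp: diag_block_mat_last Let_def)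

lemma diag_block_mat_transpose:
  "(\<And>i. i < n \<Longrightarrow> P i \<in> carrier_mat (d i) (d i)) \<Longrightarrow> (\<And>i. i < n \<Longrightarrow> transpose_mat (P i) = P i) \<Longrightarrow>
    transpose_mat (diag_block_mat (map P [0..<n])) = diag_block_mat (map P [0..<n])"
proof (induction n)
  case (Suc n)
  have "diag_block_mat (map P [0..<n]) \<in> carrier_mat (\<Sum>i<n. d i) (\<Sum>i<n. d i)" "P n \<in> carrier_mat (d n) (d n)"
    using Suc.prems by (auto intro!: diag_block_mat_carrier)
  moreover have "transpose_mat (diag_block_mat (map P [0..<n])) = diag_block_mat (map P [0..<n])"
    "transpose_mat (P n) = P n" using Suc by simp_all
  ultimately show ?case
    by (auto simp: diag_block_mat_last Let_def transpose_four_block_mat[of _ "\<Sum>i<n. d i" "\<Sum>i<n. d i" _ "d n" _ "d n"])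
qed simp

lemma diag_block_mat_mult_stack:
  "(\<And>i. i < n \<Longrightarrow> P i \<in> carrier_mat (d i) (d i)) \<Longrightarrow> (\<And>i. i < n \<Longrightarrow> x i \<in> carrier_vec (d i)) \<Longrightarrow>
    diag_block_mat (map P [0..<n]) *\<^sub>v stack x n = stack (\<lambda>i. P i *\<^sub>v x i) n"
proof (induction n)
  case 0 show ?case by (simp add: stack_0) (rule eq_vecI, auto)
next
  case (Suc n)
  have D: "diag_block_mat (map P [0..<n]) \<in> carrier_mat (\<Sum>i<n. d i) (\<Sum>i<n. d i)" "P n \<in> carrier_mat (d n) (d n)"
    using Suc.prems by (auto intro!: diag_block_mat_carrier)
  moreover have x: "stack x n \<in> carrier_vec (\<Sum>i<n. d i)" "x n \<in> carrier_vec (d n)"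
    using Suc.prems by (auto intro!: stack_carrier)
  moreover have "diag_block_mat (map P [0..<n]) *\<^sub>v stack x n = stack (\<lambda>i. P i *\<^sub>v x i) n"
    using Suc by simp
  ultimately show ?case unfolding stack_Suc using mult_mat_vec_split[OF D x]
    by (auto simp: diag_block_mat_last Let_def)
qed

lemma state_col_eq_stack: "state_col \<Gamma> x = stack x (nsys \<Gamma>)"
  by (simp add: state_col_def stack_def)

lemma stack_cong: "(\<And>i. i < n \<Longrightarrow> x i = y i) \<Longrightarrow> stack x n = stack y n"
  unfolding stack_def by (intro arg_cong[of _ _ col_vec] map_cong) auto

lemma append_vec_zero: "0\<^sub>v m @\<^sub>v 0\<^sub>v n = 0\<^sub>v (m + n)"
  by (rule eq_vecI) auto

lemma stack_zero: "stack (\<lambda>i. 0\<^sub>v (d i)) n = 0\<^sub>v (\<Sum>i<n. d i)"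
  by (induction n) (simp_all add: stack_0 stack_Suc append_vec_zero)

lemma neg_def_mat_iff:
  assumes M: "M \<in> carrier_mat m m" and sym: "transpose_mat M = M"
  shows "neg_def_mat M \<longleftrightarrow> (\<forall>y \<in> carrier_vec m. y \<noteq> 0\<^sub>v m \<longrightarrow> y \<bullet> (M *\<^sub>v y) < 0)"
proof -
  have "y \<bullet> (- M *\<^sub>v y) = - (y \<bullet> (M *\<^sub>v y))" if "y \<in> carrier_vec m" for y
    using that M by simp
  moreover have "square_mat (- M)" "transpose_mat (- M) = - M" "dim_row (- M) = m"
    using M sym by (auto simp: transpose_uminus)
  ultimately show ?thesis unfolding neg_def_mat_def pos_def_mat_def by simp
qed

text \<open>The map \<open>\<phi>\<close> renumbers the tagged entries in the order of
  \<open>v @\<^sub>v w\<close>; the coefficients are averaged with their transpose because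
  \<open>quadratic_function\<close> asks for a symmetric matrix.\<close>

lemma quad_form_imp_quadratic_function:
  assumes ij: "i \<noteq> (j :: nat)" and g: "quad_form ({i} \<times> {..<p} \<union> {j} \<times> {..<q}) g"
  shows "quadratic_function p q (\<lambda>v w. g (\<lambda>(m, r). if m = i then v $ r else w $ r))"
proof -
  let ?K = "{i} \<times> {..<p} \<union> {j} \<times> {..<q}"
  obtain M where M: "\<And>f. g f = (\<Sum>a\<in>?K. \<Sum>b\<in>?K. M a b * f a * f b)"
    using g unfolding quad_form_def by auto
  define \<phi> where "\<phi> a = (if a < p then (i, a) else (j, a - p))" for a
  have "bij_betw \<phi> {..<p + q} ?K"
    by (rule bij_betw_byWitness[where f' = "\<lambda>(m, r). if m = i then r else p + r"])
      (use ij in \<open>auto simp: \<phi>_def\<close>)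
  then have re: "(\<Sum>a\<in>?K. h a) = (\<Sum>a<p + q. h (\<phi> a))" for h :: "nat \<times> nat \<Rightarrow> real"
    by (simp add: sum.reindex_bij_betw)
  let ?S = "mat (p + q) (p + q) (\<lambda>(a, b). (M (\<phi> a) (\<phi> b) + M (\<phi> b) (\<phi> a)) / 2)"
  have "g (\<lambda>(m, r). if m = i then v $ r else w $ r) = (v @\<^sub>v w) \<bullet> (?S *\<^sub>v (v @\<^sub>v w))"
    if v: "v \<in> carrier_vec p" and w: "w \<in> carrier_vec q" for v w
  proof -
    let ?u = "v @\<^sub>v w"
    let ?f = "\<lambda>(m, r). if m = i then v $ r else w $ r"
    have u: "?u \<in> carrier_vec (p + q)" using v w by simp
    have f: "?f (\<phi> a) = ?u $ a" if "a < p + q" for a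
      using that v w ij by (auto simp: \<phi>_def)
    have "g ?f = (\<Sum>a<p + q. \<Sum>b<p + q. M (\<phi> a) (\<phi> b) * ?u $ a * ?u $ b)"
      unfolding M re by (intro sum.cong refl) (simp add: f)
    moreover from this have "g ?f = (\<Sum>a<p + q. \<Sum>b<p + q. M (\<phi> b) (\<phi> a) * ?u $ a * ?u $ b)"
      by (subst (asm) sum.swap) (simp add: mult.assoc mult.commute mult.left_commute)
    ultimately have "g ?f = (\<Sum>a<p + q. \<Sum>b<p + q. M (\<phi> a) (\<phi> b) * ?u $ a * ?u $ b) / 2
        + (\<Sum>a<p + q. \<Sum>b<p + q. M (\<phi> b) (\<phi> a) * ?u $ a * ?u $ b) / 2" by simp
    also have "\<dots> = (\<Sum>a<p + q. \<Sum>b<p + q. ?u $ a * (((M (\<phi> a) (\<phi> b) + M (\<phi> b) (\<phi> a)) / 2) * ?u $ b))"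
      unfolding sum_divide_distrib sum.distrib[symmetric] by (intro sum.cong refl) (simp add: field_simps)
    also have "\<dots> = (\<Sum>a<p + q. ?u $ a * (?S *\<^sub>v ?u) $ a)"
    proof (intro sum.cong refl)
      fix a assume a: "a \<in> {..<p + q}"
      then have "(?S *\<^sub>v ?u) $ a = (\<Sum>b<p + q. ?S $$ (a, b) * ?u $ b)"
        by (intro mult_mat_vec_index_sum[OF _ u]) auto
      then show "(\<Sum>b<p + q. ?u $ a * (((M (\<phi> a) (\<phi> b) + M (\<phi> b) (\<phi> a)) / 2) * ?u $ b)) = ?u $ a * (?S *\<^sub>v ?u) $ a"
        unfolding sum_distrib_left[symmetric] using a by simp
    qed
    also have "\<dots> = ?u \<bullet> (?S *\<^sub>v ?u)"
      by (rule scalar_prod_sum[symmetric]) (rule mult_mat_vec_carrier[OF _ u], simp)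
    finally show ?thesis .
  qed
  moreover have "transpose_mat ?S = ?S" by (rule eq_matI) (auto simp: add.commute)
  moreover have "?S \<in> carrier_mat (p + q) (p + q)" by simp
  ultimately show ?thesis unfolding quadratic_function_def by blast
qed

lemma quadratic_function_zero:
  assumes "quadratic_function p q s" shows "s (0\<^sub>v p) (0\<^sub>v q) = 0"
proof -
  obtain S where "S \<in> carrier_mat (p + q) (p + q)"
    "s (0\<^sub>v p) (0\<^sub>v q) = (0\<^sub>v p @\<^sub>v 0\<^sub>v q) \<bullet> (S *\<^sub>v (0\<^sub>v p @\<^sub>v 0\<^sub>v q))"
    using assms unfolding quadratic_function_def by force
  then show ?thesis by (simp add: append_vec_zero)
qed

section \<open>Dynamical networks\<close>

locale dynamical_network =
  fixes \<Gamma> :: network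
  assumes net: "is_network \<Gamma>"
begin

abbreviation "n \<equiv> nsys \<Gamma>"
abbreviation "d \<equiv> sdim \<Gamma>"
abbreviation "od \<equiv> odim \<Gamma>"
abbreviation "U \<equiv> uedges \<Gamma>"

abbreviation input_vecs :: "nat \<Rightarrow> (nat \<Rightarrow> real vec) \<Rightarrow> bool" where
  "input_vecs i v \<equiv> \<forall>j. (i, j) \<in> U \<longrightarrow> v j \<in> carrier_vec (od j i)"

lemma sym_U: "sym U" and irrefl_U: "irrefl U"
  using net unfolding is_network_def uedges_def by (auto simp: sym_def irrefl_def)

lemma U_lt: "(i, j) \<in> U \<Longrightarrow> i < n \<and> j < n"
  using net unfolding is_network_def uedges_def by auto

lemma nbrs_iff: "j \<in> nbrs \<Gamma> i \<longleftrightarrow> (i, j) \<in> U"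
  by (simp add: nbrs_def)

lemma nbrs_eq: "nbrs \<Gamma> i = {j \<in> {..<n}. (i, j) \<in> U}"
  using U_lt by (auto simp: nbrs_def)

lemma finite_nbrs: "finite (nbrs \<Gamma> i)"
  unfolding nbrs_eq by simp

lemma sum_nbrs: "(\<Sum>j\<in>nbrs \<Gamma> i. h j) = (\<Sum>j<n. if (i, j) \<in> U then h j else (0 :: real))"
  unfolding nbrs_eq by (rule sum.inter_filter) simp

lemma A_carrier: "i < n \<Longrightarrow> Amat \<Gamma> i \<in> carrier_mat (d i) (d i)"
  using net unfolding is_network_def by auto

lemma BCD_carrier:
  assumes "(i, j) \<in> U"
  shows "Bmat \<Gamma> i j \<in> carrier_mat (d i) (od j i)" "Cmat \<Gamma> i j \<in> carrier_mat (od i j) (d i)"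
    "Dmat \<Gamma> i j \<in> carrier_mat (od i j) (od j i)" "(i, j) \<notin> edges \<Gamma> \<Longrightarrow> od i j = 0"
  using net U_lt[OF assms] assms unfolding is_network_def nbrs_iff[symmetric] by blast+

lemma xdot_carrier:
  assumes "i < n" "x \<in> carrier_vec (d i)" "input_vecs i v"
  shows "xdot \<Gamma> i x v \<in> carrier_vec (d i)"
  unfolding xdot_def using assms A_carrier[OF assms(1)] BCD_carrier(1)[of i]
  by (auto intro!: add_carrier_vec finsum_vec_closed mult_mat_vec_carrier simp: nbrs_iff)

lemma xdot_index:
  assumes "i < n" "x \<in> carrier_vec (d i)" "input_vecs i v" "k < d i"
  shows "xdot \<Gamma> i x v $ k = (\<Sum>l<d i. Amat \<Gamma> i $$ (k, l) * x $ l)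
    + (\<Sum>j\<in>nbrs \<Gamma> i. \<Sum>l<od j i. Bmat \<Gamma> i j $$ (k, l) * v j $ l)"
proof -
  have B: "(\<lambda>j. Bmat \<Gamma> i j *\<^sub>v v j) \<in> nbrs \<Gamma> i \<rightarrow> carrier_vec (d i)"
    using assms(3) BCD_carrier(1)[of i] by (auto intro!: mult_mat_vec_carrier simp: nbrs_iff)
  have "xdot \<Gamma> i x v $ k = (Amat \<Gamma> i *\<^sub>v x) $ k + (\<Sum>j\<in>nbrs \<Gamma> i. (Bmat \<Gamma> i j *\<^sub>v v j) $ k)"
    unfolding xdot_def index_finsum_vec[OF finite_nbrs assms(4) B, symmetric]
    by (rule index_add_vec) (use finsum_vec_closed[OF B] assms(4) in auto)
  also have "(Amat \<Gamma> i *\<^sub>v x) $ k = (\<Sum>l<d i. Amat \<Gamma> i $$ (k, l) * x $ l)"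
    by (rule mult_mat_vec_index_sum[OF A_carrier]) (use assms in auto)
  also have "(\<Sum>j\<in>nbrs \<Gamma> i. (Bmat \<Gamma> i j *\<^sub>v v j) $ k) = (\<Sum>j\<in>nbrs \<Gamma> i. \<Sum>l<od j i. Bmat \<Gamma> i j $$ (k, l) * v j $ l)"
    using assms(3,4) BCD_carrier(1) by (intro sum.cong refl mult_mat_vec_index_sum) (auto simp: nbrs_iff)
  finally show ?thesis .
qed

lemma outp_carrier:
  assumes "(i, j) \<in> U" "x \<in> carrier_vec (d i)" "v \<in> carrier_vec (od j i)"
  shows "outp \<Gamma> i j x v \<in> carrier_vec (od i j)"
  unfolding outp_def using BCD_carrier[OF assms(1)] assms by (auto intro!: add_carrier_vec mult_mat_vec_carrier)

lemma outp_index: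
  assumes "(i, j) \<in> U" "x \<in> carrier_vec (d i)" "v \<in> carrier_vec (od j i)" "k < od i j"
  shows "outp \<Gamma> i j x v $ k = (\<Sum>l<d i. Cmat \<Gamma> i j $$ (k, l) * x $ l) + (\<Sum>l<od j i. Dmat \<Gamma> i j $$ (k, l) * v $ l)"
proof -
  have "outp \<Gamma> i j x v $ k = (Cmat \<Gamma> i j *\<^sub>v x) $ k + (Dmat \<Gamma> i j *\<^sub>v v) $ k"
    unfolding outp_def using BCD_carrier[OF assms(1)] assms by (intro index_add_vec) auto
  then show ?thesis
    using mult_mat_vec_index_sum[OF BCD_carrier(2)[OF assms(1)] assms(2,4)]
      mult_mat_vec_index_sum[OF BCD_carrier(3)[OF assms(1)] assms(3,4)] by simp
qed

lemma xdot_lincomb: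
  assumes "i < n" "x \<in> carrier_vec (d i)" "input_vecs i v"
    "x' \<in> carrier_vec (d i)" "input_vecs i v'"
  shows "xdot \<Gamma> i (a \<cdot>\<^sub>v x + b \<cdot>\<^sub>v x') (\<lambda>j. a \<cdot>\<^sub>v v j + b \<cdot>\<^sub>v v' j) = a \<cdot>\<^sub>v xdot \<Gamma> i x v + b \<cdot>\<^sub>v xdot \<Gamma> i x' v'"
    (is "?l = ?r")
proof (rule eq_vecI)
  note c = xdot_carrier[OF assms(1-3)] xdot_carrier[OF assms(1,4,5)]
  have l: "?l \<in> carrier_vec (d i)" using assms by (intro xdot_carrier) auto
  show "dim_vec ?l = dim_vec ?r" using l c by simp
  fix k assume "k < dim_vec ?r"
  then have k: "k < d i" using c by simp
  have v: "(a \<cdot>\<^sub>v v j + b \<cdot>\<^sub>v v' j) $ l = a * v j $ l + b * v' j $ l" if "j \<in> nbrs \<Gamma> i" "l < od j i" for j l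
  proof -
    have "v j \<in> carrier_vec (od j i)" "v' j \<in> carrier_vec (od j i)"
      using assms(3,5) that(1) by (auto simp: nbrs_iff)
    then show ?thesis using that(2) by auto
  qed
  have "?l $ k = (\<Sum>l<d i. Amat \<Gamma> i $$ (k, l) * (a * x $ l + b * x' $ l))
    + (\<Sum>j\<in>nbrs \<Gamma> i. \<Sum>l<od j i. Bmat \<Gamma> i j $$ (k, l) * (a * v j $ l + b * v' j $ l))"
    using assms(2,4) v by (subst xdot_index[OF assms(1) _ _ k]) (use assms in auto)
  also have "\<dots> = a * xdot \<Gamma> i x v $ k + b * xdot \<Gamma> i x' v' $ k"
    unfolding xdot_index[OF assms(1-3) k] xdot_index[OF assms(1,4,5) k]
    by (simp add: algebra_simps sum.distrib sum_distrib_left)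
  finally show "?l $ k = ?r $ k" using c k by simp
qed

lemma outp_lincomb:
  assumes "(i, j) \<in> U" "x \<in> carrier_vec (d i)" "v \<in> carrier_vec (od j i)" "x' \<in> carrier_vec (d i)" "v' \<in> carrier_vec (od j i)"
  shows "outp \<Gamma> i j (a \<cdot>\<^sub>v x + b \<cdot>\<^sub>v x') (a \<cdot>\<^sub>v v + b \<cdot>\<^sub>v v') = a \<cdot>\<^sub>v outp \<Gamma> i j x v + b \<cdot>\<^sub>v outp \<Gamma> i j x' v'"
    (is "?l = ?r")
proof (rule eq_vecI)
  note c = outp_carrier[OF assms(1-3)] outp_carrier[OF assms(1,4,5)]
  have l: "?l \<in> carrier_vec (od i j)" using assms by (intro outp_carrier) auto
  show "dim_vec ?l = dim_vec ?r" using l c by simp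
  fix k assume "k < dim_vec ?r"
  then have k: "k < od i j" using c by simp
  have "?l $ k = (\<Sum>l<d i. Cmat \<Gamma> i j $$ (k, l) * (a * x $ l + b * x' $ l))
    + (\<Sum>l<od j i. Dmat \<Gamma> i j $$ (k, l) * (a * v $ l + b * v' $ l))"
    by (subst outp_index[OF assms(1) _ _ k]) (use assms in auto)
  also have "\<dots> = a * outp \<Gamma> i j x v $ k + b * outp \<Gamma> i j x' v' $ k"
    unfolding outp_index[OF assms(1-3) k] outp_index[OF assms(1,4,5) k]
    by (simp add: algebra_simps sum.distrib sum_distrib_left)
  finally show "?l $ k = ?r $ k" using c k by simp
qed

lemma signals_iff:
  "signals \<Gamma> x v w \<longleftrightarrow> (\<forall>i j. (i, j) \<in> U \<longrightarrow>
        v i j \<in> carrier_vec (od j i) \<and> w i j \<in> carrier_vec (od i j) \<and>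
        w i j = outp \<Gamma> i j (x i) (v i j)) \<and> (\<forall>i j. (i, j) \<in> edges \<Gamma> \<longrightarrow> v j i = w i j)"
  unfolding signals_def nbrs_iff Ball_def using U_lt by blast

lemma signals_lincomb:
  assumes "states \<Gamma> x" "states \<Gamma> x'" "signals \<Gamma> x v w" "signals \<Gamma> x' v' w'"
  shows "signals \<Gamma> (\<lambda>i. a \<cdot>\<^sub>v x i + b \<cdot>\<^sub>v x' i) (\<lambda>i j. a \<cdot>\<^sub>v v i j + b \<cdot>\<^sub>v v' i j) (\<lambda>i j. a \<cdot>\<^sub>v w i j + b \<cdot>\<^sub>v w' i j)"
proof -
  note s = assms(3,4)[unfolded signals_iff]
  have "a \<cdot>\<^sub>v w i j + b \<cdot>\<^sub>v w' i j = outp \<Gamma> i j (a \<cdot>\<^sub>v x i + b \<cdot>\<^sub>v x' i) (a \<cdot>\<^sub>v v i j + b \<cdot>\<^sub>v v' i j)"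
    if "(i, j) \<in> U" for i j
    using s that U_lt[OF that] assms(1,2) by (subst outp_lincomb[OF that]) (auto simp: states_def)
  moreover have "a \<cdot>\<^sub>v v i j + b \<cdot>\<^sub>v v' i j \<in> carrier_vec (od j i)"
      "a \<cdot>\<^sub>v w i j + b \<cdot>\<^sub>v w' i j \<in> carrier_vec (od i j)" if "(i, j) \<in> U" for i j
    using s that by (metis add_carrier_vec smult_carrier_vec)+
  ultimately show ?thesis unfolding signals_iff using s by simp
qed

lemma xdot_cong:
  assumes "i < n" "x \<in> carrier_vec (d i)" "input_vecs i v"
    and eq: "\<And>j. (i, j) \<in> U \<Longrightarrow> v j = v' j"
  shows "xdot \<Gamma> i x v = xdot \<Gamma> i x v'"
proof (rule eq_vecI)
  have v': "input_vecs i v'" using assms(3) eq by metis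
  note c = xdot_carrier[OF assms(1-3)] xdot_carrier[OF assms(1,2) v']
  show "dim_vec (xdot \<Gamma> i x v) = dim_vec (xdot \<Gamma> i x v')" using c by simp
  fix k assume "k < dim_vec (xdot \<Gamma> i x v')"
  then have k: "k < d i" using c by simp
  show "xdot \<Gamma> i x v $ k = xdot \<Gamma> i x v' $ k"
    unfolding xdot_index[OF assms(1-3) k] xdot_index[OF assms(1,2) v' k]
    using eq by (auto simp: nbrs_iff intro!: sum.cong)
qed

lemma xdot_carrier_signals:
  assumes "states \<Gamma> x" "signals \<Gamma> x v w" "i < n"
  shows "x i \<in> carrier_vec (d i)" "input_vecs i (v i)" "xdot \<Gamma> i (x i) (v i) \<in> carrier_vec (d i)"
proof -
  show *: "x i \<in> carrier_vec (d i)" "input_vecs i (v i)"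
    using assms by (auto simp: states_def signals_iff)
  show "xdot \<Gamma> i (x i) (v i) \<in> carrier_vec (d i)" by (rule xdot_carrier[OF assms(3) *])
qed

section \<open>Well-posedness, the closed loop and the derivative of the Lyapunov function\<close>

lemma signals_unique:
  assumes "well_posed \<Gamma>" "states \<Gamma> x" "signals \<Gamma> x v w" "signals \<Gamma> x v' w'" "(i, j) \<in> U"
  shows "v i j = v' i j"
  using assms U_lt[OF assms(5)] unfolding well_posed_def nbrs_iff[symmetric] by metis

lemma signals_cong:
  assumes "signals \<Gamma> x v w" "\<And>i. i < n \<Longrightarrow> x i = x' i" shows "signals \<Gamma> x' v w"
  using assms U_lt unfolding signals_iff by metis

text \<open>Linear combinations of admissible signals are admissible, and by uniqueness they are the
  chosen ones. The state derivative is therefore a linear function of the state and has a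
  matrix.\<close>

lemma closed_loop_exists:
  assumes wp: "well_posed \<Gamma>"
  shows "\<exists>\<A>. closed_loop \<Gamma> \<A>"
proof -
  define V where "V x = (SOME v. \<exists>w. signals \<Gamma> x v w)" for x
  have V: "\<exists>w. signals \<Gamma> x (V x) w" if "states \<Gamma> x" for x
  proof -
    have "\<exists>v w. signals \<Gamma> x v w" using wp that unfolding well_posed_def by blast
    then show ?thesis unfolding V_def by (rule someI_ex)
  qed
  define D where "D x i = xdot \<Gamma> i (x i) (V x i)" for x i
  \<comment> \<open>\<open>x\<close> and \<open>x'\<close> need only agree below \<open>n\<close>: a
    state is a function on all indices, and the choice \<open>V\<close> may depend on the irrelevant
    ones.\<close>
  have D_eq: "D x i = xdot \<Gamma> i (x' i) (v i)" if x: "states \<Gamma> x" "states \<Gamma> x'" "signals \<Gamma> x' v w" "i < n"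
    "\<And>i. i < n \<Longrightarrow> x i = x' i" for x x' v w i
  proof -
    obtain u where u: "signals \<Gamma> x (V x) u" using V x(1) by blast
    have v: "signals \<Gamma> x v w" by (rule signals_cong[OF x(3)]) (simp add: x(5))
    note c = xdot_carrier_signals[OF x(1) u x(4)]
    show ?thesis unfolding D_def x(5)[OF x(4), symmetric]
      by (rule xdot_cong[OF x(4) c(1,2)]) (rule signals_unique[OF wp x(1) u v])
  qed
  have unstack: "states \<Gamma> (unstack d y)" for y by (simp add: states_def)
  have Dc: "D x i \<in> carrier_vec (d i)" if "states \<Gamma> x" "i < n" for x i
    using V[OF that(1)] xdot_carrier_signals[OF that(1) _ that(2)] unfolding D_def by blast
  let ?\<phi> = "\<lambda>y. stack (D (unstack d y)) n"
  have "\<exists>\<A> \<in> carrier_mat (state_dim \<Gamma>) (state_dim \<Gamma>). \<forall>y \<in> carrier_vec (state_dim \<Gamma>). ?\<phi> y = \<A> *\<^sub>v y"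
    unfolding state_dim_def
  proof (rule linear_imp_mult_mat_vec)
    show "?\<phi> y \<in> carrier_vec (sum d {..<n})" for y
      by (rule stack_carrier) (rule Dc[OF unstack])
    fix a b and y z :: "real vec" assume y: "y \<in> carrier_vec (sum d {..<n})" and z: "z \<in> carrier_vec (sum d {..<n})"
    obtain u where u: "signals \<Gamma> (unstack d y) (V (unstack d y)) u" using V unstack by blast
    obtain w where w: "signals \<Gamma> (unstack d z) (V (unstack d z)) w" using V unstack by blast
    have "D (unstack d (a \<cdot>\<^sub>v y + b \<cdot>\<^sub>v z)) i = a \<cdot>\<^sub>v D (unstack d y) i + b \<cdot>\<^sub>v D (unstack d z) i" if i: "i < n" for i
    proof -
      have "D (unstack d (a \<cdot>\<^sub>v y + b \<cdot>\<^sub>v z)) i = xdot \<Gamma> i (a \<cdot>\<^sub>v unstack d y i + b \<cdot>\<^sub>v unstack d z i)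
        (\<lambda>j. a \<cdot>\<^sub>v V (unstack d y) i j + b \<cdot>\<^sub>v V (unstack d z) i j)"
        using unstack_lincomb[OF y z]
        by (intro D_eq[OF unstack _ signals_lincomb[OF unstack unstack u w] i]) (auto simp: states_def)
      also have "\<dots> = a \<cdot>\<^sub>v D (unstack d y) i + b \<cdot>\<^sub>v D (unstack d z) i" unfolding D_def
        using xdot_carrier_signals[OF unstack u i] xdot_carrier_signals[OF unstack w i]
        by (intro xdot_lincomb i) auto
      finally show ?thesis .
    qed
    then have "?\<phi> (a \<cdot>\<^sub>v y + b \<cdot>\<^sub>v z) = stack (\<lambda>i. a \<cdot>\<^sub>v D (unstack d y) i + b \<cdot>\<^sub>v D (unstack d z) i) n"
      by (rule stack_cong)
    also have "\<dots> = a \<cdot>\<^sub>v ?\<phi> y + b \<cdot>\<^sub>v ?\<phi> z"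
      by (rule stack_lincomb) (auto intro: Dc[OF unstack])
    finally show "?\<phi> (a \<cdot>\<^sub>v y + b \<cdot>\<^sub>v z) = a \<cdot>\<^sub>v ?\<phi> y + b \<cdot>\<^sub>v ?\<phi> z" .
  qed
  then obtain \<A> where A: "\<A> \<in> carrier_mat (state_dim \<Gamma>) (state_dim \<Gamma>)"
    "\<And>y. y \<in> carrier_vec (state_dim \<Gamma>) \<Longrightarrow> ?\<phi> y = \<A> *\<^sub>v y" by blast
  have "state_col \<Gamma> (\<lambda>i. xdot \<Gamma> i (x i) (v i)) = \<A> *\<^sub>v state_col \<Gamma> x"
    if x: "states \<Gamma> x" "signals \<Gamma> x v w" for x v w
  proof -
    have xc: "x i \<in> carrier_vec (d i)" if "i < n" for i using x(1) that by (simp add: states_def)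
    have "D (unstack d (stack x n)) i = xdot \<Gamma> i (x i) (v i)" if "i < n" for i
      by (rule D_eq[OF unstack x that]) (rule unstack_stack[OF xc])
    then have "?\<phi> (stack x n) = stack (\<lambda>i. xdot \<Gamma> i (x i) (v i)) n"
      by (rule stack_cong)
    then show ?thesis unfolding state_col_eq_stack
      using A(2)[of "stack x n"] stack_carrier[of n x d] xc by (simp add: state_dim_def)
  qed
  then show ?thesis using A(1) unfolding closed_loop_def by blast
qed

text \<open>Since the blocks \<open>P i\<close> are symmetric, both terms contribute the same
  number, and block diagonality splits it over the systems.\<close>

lemma lyapunov_derivative:
  assumes P: "\<And>i. i < n \<Longrightarrow> P i \<in> carrier_mat (d i) (d i)" "\<And>i. i < n \<Longrightarrow> transpose_mat (P i) = P i"
    and A: "closed_loop \<Gamma> \<A>" and x: "states \<Gamma> x" "signals \<Gamma> x v w"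
  defines "Q \<equiv> diag_block_mat (map P [0..<n])"
  shows "state_col \<Gamma> x \<bullet> ((transpose_mat \<A> * Q + Q * \<A>) *\<^sub>v state_col \<Gamma> x)
    = (\<Sum>i<n. 2 * (x i \<bullet> (P i *\<^sub>v xdot \<Gamma> i (x i) (v i))))"
proof -
  let ?N = "sum d {..<n}" and ?y = "stack x n" and ?x' = "\<lambda>i. xdot \<Gamma> i (x i) (v i)"
  note c = xdot_carrier_signals[OF x]
  have Ac: "\<A> \<in> carrier_mat ?N ?N" using A unfolding closed_loop_def state_dim_def by simp
  have Ay: "\<A> *\<^sub>v ?y = stack ?x' n"
    using A x unfolding closed_loop_def state_col_eq_stack by metis
  have Qc: "Q \<in> carrier_mat ?N ?N" unfolding Q_def by (rule diag_block_mat_carrier) (rule P)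
  have yc: "?y \<in> carrier_vec ?N" by (rule stack_carrier) (rule c)
  have Qs: "Q *\<^sub>v stack z n = stack (\<lambda>i. P i *\<^sub>v z i) n" if "\<And>i. i < n \<Longrightarrow> z i \<in> carrier_vec (d i)" for z
    unfolding Q_def by (rule diag_block_mat_mult_stack) (use P that in auto)
  have "(transpose_mat \<A> * Q + Q * \<A>) *\<^sub>v ?y = transpose_mat \<A> *\<^sub>v (Q *\<^sub>v ?y) + Q *\<^sub>v (\<A> *\<^sub>v ?y)"
    using Ac Qc yc by (subst add_mult_distrib_mat_vec[of _ ?N ?N]) (auto simp: assoc_mult_mat_vec[of _ ?N ?N _ ?N])
  moreover have "?y \<bullet> (transpose_mat \<A> *\<^sub>v (Q *\<^sub>v ?y)) = (Q *\<^sub>v ?y) \<bullet> (\<A> *\<^sub>v ?y)"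
    using transpose_vec_mult_scalar[OF Ac yc, of "Q *\<^sub>v ?y"] Ac Qc yc
    by (subst comm_scalar_prod[of _ ?N]) auto
  ultimately have "?y \<bullet> ((transpose_mat \<A> * Q + Q * \<A>) *\<^sub>v ?y) = (Q *\<^sub>v ?y) \<bullet> (\<A> *\<^sub>v ?y) + ?y \<bullet> (Q *\<^sub>v (\<A> *\<^sub>v ?y))"
    using Ac Qc yc by (simp add: scalar_prod_add_distrib[of _ ?N])
  also have "\<dots> = (\<Sum>i<n. (P i *\<^sub>v x i) \<bullet> ?x' i) + (\<Sum>i<n. x i \<bullet> (P i *\<^sub>v ?x' i))"
  proof -
    have "Q *\<^sub>v ?y = stack (\<lambda>i. P i *\<^sub>v x i) n" "Q *\<^sub>v stack ?x' n = stack (\<lambda>i. P i *\<^sub>v ?x' i) n"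
      by (rule Qs, rule c, assumption)+
    moreover have "stack (\<lambda>i. P i *\<^sub>v x i) n \<bullet> stack ?x' n = (\<Sum>i<n. (P i *\<^sub>v x i) \<bullet> ?x' i)"
      "stack x n \<bullet> stack (\<lambda>i. P i *\<^sub>v ?x' i) n = (\<Sum>i<n. x i \<bullet> (P i *\<^sub>v ?x' i))"
      by (rule stack_scalar_prod[of n _ d]; use c P(1) in \<open>auto intro!: mult_mat_vec_carrier\<close>)+
    ultimately show ?thesis unfolding Ay by simp
  qed
  also have "(\<Sum>i<n. (P i *\<^sub>v x i) \<bullet> ?x' i) = (\<Sum>i<n. x i \<bullet> (P i *\<^sub>v ?x' i))"
  proof (intro sum.cong refl)
    fix i assume "i \<in> {..<n}"
    then have i: "i < n" by simp
    show "(P i *\<^sub>v x i) \<bullet> ?x' i = x i \<bullet> (P i *\<^sub>v ?x' i)"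
      using transpose_vec_mult_scalar[OF P(1)[OF i] c(3)[OF i] c(1)[OF i]] P(2)[OF i] by simp
  qed
  finally show ?thesis unfolding state_col_eq_stack by (simp add: sum_distrib_left)
qed

text \<open>This removes the matrix \<open>\<A>\<close> from the problem: every vector of the right
  dimension is a stacked state, every state has signals by well-posedness, and the Lyapunov form is
  then the sum of the storage rates.\<close>

lemma additive_quadratic_lyapunov_iff:
  assumes wp: "well_posed \<Gamma>"
    and P: "\<And>i. i < n \<Longrightarrow> P i \<in> carrier_mat (d i) (d i)" "\<And>i. i < n \<Longrightarrow> transpose_mat (P i) = P i"
  shows "additive_quadratic_lyapunov \<Gamma> P \<longleftrightarrow> (\<forall>x v w. states \<Gamma> x \<longrightarrow> signals \<Gamma> x v w \<longrightarrow>
    (\<exists>i<n. x i \<noteq> 0\<^sub>v (d i)) \<longrightarrow> (\<Sum>i<n. 2 * (x i \<bullet> (P i *\<^sub>v xdot \<Gamma> i (x i) (v i)))) < 0)"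
    (is "?L \<longleftrightarrow> ?R")
proof -
  let ?N = "sum d {..<n}"
  define Q where "Q = diag_block_mat (map P [0..<n])"
  have Qc: "Q \<in> carrier_mat ?N ?N" unfolding Q_def by (rule diag_block_mat_carrier) (rule P)
  have Qt: "transpose_mat Q = Q" unfolding Q_def by (rule diag_block_mat_transpose) (rule P, assumption)+
  have zero_iff: "state_col \<Gamma> x = 0\<^sub>v ?N \<longleftrightarrow> (\<forall>i<n. x i = 0\<^sub>v (d i))" if "states \<Gamma> x" for x
  proof -
    have xc: "\<And>i. i < n \<Longrightarrow> x i \<in> carrier_vec (d i)" using that by (simp add: states_def)
    have "stack x n = 0\<^sub>v ?N \<Longrightarrow> i < n \<Longrightarrow> x i = 0\<^sub>v (d i)" for i
      using stack_inj[of n x d "\<lambda>i. 0\<^sub>v (d i)" i] xc stack_zero[of d n] by simp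
    moreover have "stack x n = 0\<^sub>v ?N" if "\<forall>i<n. x i = 0\<^sub>v (d i)"
      unfolding stack_zero[symmetric] by (rule stack_cong) (use that in simp)
    ultimately show ?thesis unfolding state_col_eq_stack by blast
  qed
  have neg_iff: "neg_def_mat (transpose_mat \<A> * Q + Q * \<A>) \<longleftrightarrow> ?R" if A: "closed_loop \<Gamma> \<A>" for \<A>
  proof -
    let ?M = "transpose_mat \<A> * Q + Q * \<A>"
    have Ac: "\<A> \<in> carrier_mat ?N ?N" using A unfolding closed_loop_def state_dim_def by simp
    have Mc: "?M \<in> carrier_mat ?N ?N" using Ac Qc by auto
    have "transpose_mat ?M = ?M"
      using Ac Qc Qt by (simp add: transpose_add[of _ ?N ?N] transpose_mult[of _ ?N ?N _ ?N] comm_add_mat[of _ ?N ?N])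
    then have "neg_def_mat ?M \<longleftrightarrow> (\<forall>y \<in> carrier_vec ?N. y \<noteq> 0\<^sub>v ?N \<longrightarrow> y \<bullet> (?M *\<^sub>v y) < 0)"
      by (rule neg_def_mat_iff[OF Mc])
    also have "\<dots> \<longleftrightarrow> ?R"
    proof (intro iffI allI impI ballI)
      fix x v w assume x: "states \<Gamma> x" "signals \<Gamma> x v w" "\<exists>i<n. x i \<noteq> 0\<^sub>v (d i)"
        and "\<forall>y \<in> carrier_vec ?N. y \<noteq> 0\<^sub>v ?N \<longrightarrow> y \<bullet> (?M *\<^sub>v y) < 0"
      moreover have "state_col \<Gamma> x \<in> carrier_vec ?N"
        unfolding state_col_eq_stack by (rule stack_carrier) (use x in \<open>simp add: states_def\<close>)
      ultimately have "state_col \<Gamma> x \<bullet> (?M *\<^sub>v state_col \<Gamma> x) < 0" using zero_iff[OF x(1)] by auto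
      then show "(\<Sum>i<n. 2 * (x i \<bullet> (P i *\<^sub>v xdot \<Gamma> i (x i) (v i)))) < 0"
        using lyapunov_derivative[OF P A x(1,2)] unfolding Q_def by simp
    next
      fix y :: "real vec" assume R: ?R and y: "y \<in> carrier_vec ?N" "y \<noteq> 0\<^sub>v ?N"
      have s: "states \<Gamma> (unstack d y)" by (simp add: states_def)
      then obtain v w where vw: "signals \<Gamma> (unstack d y) v w" using wp unfolding well_posed_def by blast
      have yp: "state_col \<Gamma> (unstack d y) = y" unfolding state_col_eq_stack by (rule stack_unstack[OF y(1)])
      then have "\<exists>i<n. unstack d y i \<noteq> 0\<^sub>v (d i)" using zero_iff[OF s] y(2) by auto
      then show "y \<bullet> (?M *\<^sub>v y) < 0"
        using R s vw lyapunov_derivative[OF P A s vw] unfolding Q_def yp by auto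
    qed
    finally show ?thesis .
  qed
  show ?thesis unfolding additive_quadratic_lyapunov_def Let_def Q_def[symmetric]
    using neg_iff closed_loop_exists[OF wp] by blast
qed

section \<open>States and signals as coordinates\<close>

text \<open>A state and all inputs of all systems are encoded in one function \<open>f\<close>: \<open>f (i, 0, k)\<close> is entry \<open>k\<close> of \<open>x\<^sub>i\<close>,
  and \<open>f (i, Suc j, k)\<close> is entry \<open>k\<close> of \<open>v\<^sub>i\<^sub>j\<close>.\<close>

definition xs :: "(nat \<times> nat \<times> nat \<Rightarrow> real) \<Rightarrow> nat \<Rightarrow> real vec" where
  "xs f i = vec (d i) (\<lambda>k. f (i, 0, k))"

definition vs :: "(nat \<times> nat \<times> nat \<Rightarrow> real) \<Rightarrow> nat \<Rightarrow> nat \<Rightarrow> real vec" where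
  "vs f i j = vec (od j i) (\<lambda>k. f (i, Suc j, k))"

definition coords :: "nat \<Rightarrow> (nat \<times> nat \<times> nat) set" where
  "coords i = (\<lambda>k. (i, 0, k)) ` {..<d i} \<union> (\<Union>j\<in>nbrs \<Gamma> i. (\<lambda>k. (i, Suc j, k)) ` {..<od j i})"

text \<open>On the edge between \<open>G\<^sub>i\<close> and \<open>G\<^sub>j\<close>, the pair \<open>(i, r)\<close> stands for entry \<open>r\<close> of the signal into \<open>G\<^sub>i\<close>, which is
  \<open>v\<^sub>i\<^sub>j\<close> seen from \<open>G\<^sub>i\<close> and \<open>w\<^sub>j\<^sub>i\<close> seen from \<open>G\<^sub>j\<close>.\<close>

definition ports :: "nat \<Rightarrow> nat \<Rightarrow> (nat \<times> nat) set" where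
  "ports i j = {i} \<times> {..<od j i} \<union> {j} \<times> {..<od i j}"

text \<open>An edge signal as G_i sees it: a coordinate if it is an input of G_i, a computed output
  otherwise. One of \<open>port i j k f\<close> and \<open>port j i k f\<close> is the input and the
  other the output, so their difference is an interconnection defect.\<close>

definition port :: "nat \<Rightarrow> nat \<Rightarrow> nat \<times> nat \<Rightarrow> (nat \<times> nat \<times> nat \<Rightarrow> real) \<Rightarrow> real" where
  "port i j k f = (if fst k = i then f (i, Suc j, snd k) else outp \<Gamma> i j (xs f i) (vs f i j) $ snd k)"

lemma xs_carrier [simp]: "xs f i \<in> carrier_vec (d i)" and vs_carrier [simp]: "vs f i j \<in> carrier_vec (od j i)"
  by (simp_all add: xs_def vs_def)

lemma finite_coords: "finite (coords i)"
  unfolding coords_def using finite_nbrs by auto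

lemma coords_disjoint: "i \<noteq> j \<Longrightarrow> coords i \<inter> coords j = {}"
  unfolding coords_def by auto

lemma ports_sym: "ports i j = ports j i"
  unfolding ports_def by auto

lemma finite_ports: "finite (ports i j)"
  unfolding ports_def by simp

lemma lin_form_xs: "k < d i \<Longrightarrow> lin_form (coords i) (\<lambda>f. xs f i $ k)"
  unfolding xs_def by (simp, rule lin_form_coord[OF finite_coords]) (auto simp: coords_def)

lemma lin_form_v: "(i, j) \<in> U \<Longrightarrow> k < od j i \<Longrightarrow> lin_form (coords i) (\<lambda>f. f (i, Suc j, k))"
  by (rule lin_form_coord[OF finite_coords]) (auto simp: coords_def nbrs_iff)

lemma lin_form_vs: "(i, j) \<in> U \<Longrightarrow> k < od j i \<Longrightarrow> lin_form (coords i) (\<lambda>f. vs f i j $ k)"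
  unfolding vs_def using lin_form_v by simp

lemma lin_form_xdot:
  assumes "i < n" "k < d i" shows "lin_form (coords i) (\<lambda>f. xdot \<Gamma> i (xs f i) (vs f i) $ k)"
proof -
  have "lin_form (coords i) (\<lambda>f. (\<Sum>l<d i. Amat \<Gamma> i $$ (k, l) * xs f i $ l)
    + (\<Sum>j\<in>nbrs \<Gamma> i. \<Sum>l<od j i. Bmat \<Gamma> i j $$ (k, l) * vs f i j $ l))"
    by (intro lin_form_add lin_form_sum lin_form_scale lin_form_xs lin_form_vs) (auto simp: nbrs_iff)
  then show ?thesis by (subst xdot_index[OF assms(1) _ _ assms(2)]) auto
qed

lemma lin_form_port:
  assumes "(i, j) \<in> U" "k \<in> ports i j" shows "lin_form (coords i) (port i j k)"
proof (cases "fst k = i")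
  case True
  have "snd k < od j i"
    using assms irrefl_U True by (auto simp: ports_def irrefl_def)
  then show ?thesis unfolding port_def using lin_form_v[OF assms(1)] True by simp
next
  case False
  then have k: "snd k < od i j" using assms(2) by (auto simp: ports_def)
  have "lin_form (coords i) (\<lambda>f. (\<Sum>l<d i. Cmat \<Gamma> i j $$ (snd k, l) * xs f i $ l)
      + (\<Sum>l<od j i. Dmat \<Gamma> i j $$ (snd k, l) * vs f i j $ l))"
    using assms(1) by (intro lin_form_add lin_form_sum lin_form_scale lin_form_xs lin_form_vs) auto
  then have "lin_form (coords i) (\<lambda>f. outp \<Gamma> i j (xs f i) (vs f i j) $ snd k)"
    by (subst outp_index[OF assms(1) _ _ k]) auto
  then show ?thesis unfolding port_def using False by simp
qed

lemma quad_form_storage_rate: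
  assumes "i < n" "R \<in> carrier_mat (d i) (d i)"
  shows "quad_form (coords i) (\<lambda>f. 2 * (xs f i \<bullet> (R *\<^sub>v xdot \<Gamma> i (xs f i) (vs f i))))"
proof -
  have xd: "xdot \<Gamma> i (xs f i) (vs f i) \<in> carrier_vec (d i)" for f by (rule xdot_carrier[OF assms(1)]) auto
  have "quad_form (coords i) (\<lambda>f. 2 * (\<Sum>k<d i. xs f i $ k * (\<Sum>l<d i. R $$ (k, l) * xdot \<Gamma> i (xs f i) (vs f i) $ l)))"
    using assms(1)
    by (intro quad_form_scale quad_form_sum quad_form_mult lin_form_xs lin_form_sum lin_form_scale lin_form_xdot) auto
  moreover have "xs f i \<bullet> (R *\<^sub>v xdot \<Gamma> i (xs f i) (vs f i))
      = (\<Sum>k<d i. xs f i $ k * (\<Sum>l<d i. R $$ (k, l) * xdot \<Gamma> i (xs f i) (vs f i) $ l))" for f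
    unfolding scalar_prod_sum[OF mult_mat_vec_carrier[OF assms(2) xd]]
    by (intro sum.cong refl arg_cong2[of _ _ _ _ "(*)"] mult_mat_vec_index_sum[OF assms(2) xd]) auto
  ultimately show ?thesis by simp
qed

lemma signals_of_ports:
  assumes "\<And>i j k. (i, j) \<in> U \<Longrightarrow> k \<in> ports i j \<Longrightarrow> port i j k f = port j i k f"
  shows "signals \<Gamma> (xs f) (vs f) (\<lambda>i j. outp \<Gamma> i j (xs f i) (vs f i j))"
proof -
  have "vs f j i = outp \<Gamma> i j (xs f i) (vs f i j)" if e: "(i, j) \<in> edges \<Gamma>" for i j
  proof (rule eq_vecI)
    have U: "(i, j) \<in> U" using e by (simp add: uedges_def)
    have ij: "i \<noteq> j" using U irrefl_U by (auto simp: irrefl_def)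
    have w: "outp \<Gamma> i j (xs f i) (vs f i j) \<in> carrier_vec (od i j)" by (rule outp_carrier[OF U]) auto
    then show "dim_vec (vs f j i) = dim_vec (outp \<Gamma> i j (xs f i) (vs f i j))" by (simp add: vs_def)
    fix r assume "r < dim_vec (outp \<Gamma> i j (xs f i) (vs f i j))"
    then have r: "r < od i j" using w by simp
    \<comment> \<open>Signal \<open>(j, r)\<close> is an output of G_i and an input of G_j.\<close>
    have "port i j (j, r) f = port j i (j, r) f" by (rule assms[OF U]) (simp add: ports_def r)
    then show "vs f j i $ r = outp \<Gamma> i j (xs f i) (vs f i j) $ r"
      using ij r by (simp add: port_def vs_def)
  qed
  then show ?thesis unfolding signals_iff by (auto intro: outp_carrier)
qed

lemma signals_zero: "signals \<Gamma> (\<lambda>i. 0\<^sub>v (d i)) (\<lambda>i j. 0\<^sub>v (od j i)) (\<lambda>i j. 0\<^sub>v (od i j))"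
  and outp_zero: "(i, j) \<in> U \<Longrightarrow> outp \<Gamma> i j (0\<^sub>v (d i)) (0\<^sub>v (od j i)) = 0\<^sub>v (od i j)"
proof -
  show "outp \<Gamma> i j (0\<^sub>v (d i)) (0\<^sub>v (od j i)) = 0\<^sub>v (od i j)" if "(i, j) \<in> U" for i j
  proof -
    have "M *\<^sub>v 0\<^sub>v b = 0\<^sub>v a" if "M \<in> carrier_mat a b" for M :: "real mat" and a b
      using that by (intro eq_vecI) (auto intro!: scalar_prod_right_zero)
    from this[OF BCD_carrier(2)[OF that]] this[OF BCD_carrier(3)[OF that]] show ?thesis
      unfolding outp_def by simp
  qed
  then show "signals \<Gamma> (\<lambda>i. 0\<^sub>v (d i)) (\<lambda>i j. 0\<^sub>v (od j i)) (\<lambda>i j. 0\<^sub>v (od i j))"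
    unfolding signals_iff by simp
qed

text \<open>At zero state the zero signals are admissible, hence the only ones. Negativity for
  nonzero states thus covers all nonzero interconnected coordinates, as Finsler's lemma
  demands.\<close>

lemma signals_nonzero_state:
  assumes wp: "well_posed \<Gamma>" and f: "signals \<Gamma> (xs f) (vs f) w" "i < n" "a \<in> coords i" "f a \<noteq> 0"
  shows "\<exists>i<n. xs f i \<noteq> 0\<^sub>v (d i)"
proof (rule ccontr)
  assume "\<not> ?thesis"
  then have x0: "xs f i = 0\<^sub>v (d i)" if "i < n" for i using that by auto
  have z: "signals \<Gamma> (xs f) (\<lambda>i j. 0\<^sub>v (od j i)) (\<lambda>i j. 0\<^sub>v (od i j))"
    by (rule signals_cong[OF signals_zero]) (simp add: x0)
  have v0: "vs f i j = 0\<^sub>v (od j i)" if "(i, j) \<in> U" for j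
    by (rule signals_unique[OF wp _ f(1) z that]) (simp add: states_def)
  have "f (i, 0, k) = xs f i $ k" if "k < d i" for k using that by (simp add: xs_def)
  moreover have "f (i, Suc j, k) = vs f i j $ k" if "k < od j i" for j k using that by (simp add: vs_def)
  ultimately have "f a = 0" using f(3) x0[OF f(2)] v0 by (auto simp: coords_def nbrs_iff)
  then show False using f(4) by simp
qed

text \<open>An edge form knows each signal by its receiver: the input \<open>v\<close> of G_i goes
  under \<open>i\<close>, its output \<open>w\<close> under the other name. Seen from the opposite
  end, \<open>v\<close> and \<open>w\<close> are exchanged while the form keeps its
  arguments.\<close>

definition pair_supply :: "nat \<Rightarrow> ((nat \<times> nat \<Rightarrow> real) \<Rightarrow> real) \<Rightarrow> real vec \<Rightarrow> real vec \<Rightarrow> real" where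
  "pair_supply i s v w = s (\<lambda>(m, r). if m = i then v $ r else w $ r)"

lemma pair_supply_port:
  assumes "(i, j) \<in> U" "quad_form (ports i j) s" "vs f i j = v"
  shows "pair_supply i s v (outp \<Gamma> i j (xs f i) v) = s (\<lambda>k. port i j k f)"
  unfolding pair_supply_def
proof (rule quad_form_cong[OF assms(2)])
  have ij: "i \<noteq> j" using assms(1) irrefl_U by (auto simp: irrefl_def)
  fix k assume "k \<in> ports i j"
  then show "(case k of (m, r) \<Rightarrow> if m = i then v $ r else outp \<Gamma> i j (xs f i) v $ r) = port i j k f"
    unfolding assms(3)[symmetric] ports_def port_def vs_def using ij by auto
qed

text \<open>The margin \<open>\<epsilon>\<close> makes the inequality strict at every nonzero pair
  of state and inputs, including those with zero state.\<close>

lemma local_supplies_imp_dissipative: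
  assumes i: "i < n" and \<epsilon>: "0 < \<epsilon>"
    and s: "\<And>j. (i, j) \<in> U \<Longrightarrow> quad_form (ports i j) (s j)"
    and le: "\<And>f. 2 * (xs f i \<bullet> (R *\<^sub>v xdot \<Gamma> i (xs f i) (vs f i))) + \<epsilon> * (\<Sum>a\<in>coords i. (f a)\<^sup>2)
      \<le> (\<Sum>j<n. if (i, j) \<in> U then s j (\<lambda>k. port i j k f) else 0)"
  shows "strictly_dissipative \<Gamma> i R (\<lambda>j. pair_supply i (s j))"
  unfolding strictly_dissipative_def
proof (intro allI impI)
  fix x :: "real vec" and v :: "nat \<Rightarrow> real vec" assume x: "x \<in> carrier_vec (d i)" and v: "\<forall>j\<in>nbrs \<Gamma> i. v j \<in> carrier_vec (od j i)"
    and nz: "x \<noteq> 0\<^sub>v (d i) \<or> (\<exists>j\<in>nbrs \<Gamma> i. v j \<noteq> 0\<^sub>v (od j i))"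
  \<comment> \<open>Inverts the encoding by \<open>xs\<close> and \<open>vs\<close>. The system
    index is ignored because only coordinates of \<open>i\<close> are evaluated.\<close>
  define f where "f = (\<lambda>(l :: nat, m, k). case m of 0 \<Rightarrow> x $ k | Suc j \<Rightarrow> v j $ k)"
  have xf: "xs f i = x" using x by (intro eq_vecI) (auto simp: xs_def f_def)
  have vf: "vs f i j = v j" if "(i, j) \<in> U" for j
  proof -
    have "v j \<in> carrier_vec (od j i)" using v that by (simp add: nbrs_iff)
    then show ?thesis by (intro eq_vecI) (auto simp: vs_def f_def)
  qed
  have xd: "xdot \<Gamma> i (xs f i) (vs f i) = xdot \<Gamma> i x v"
    unfolding xf using v by (intro xdot_cong[OF i x]) (auto simp: vf nbrs_iff)
  have "\<exists>a\<in>coords i. f a \<noteq> 0"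
  proof (rule ccontr)
    assume "\<not> ?thesis"
    then have f0: "f a = 0" if "a \<in> coords i" for a using that by blast
    have "x = 0\<^sub>v (d i)"
    proof (rule eq_vecI)
      fix k assume "k < dim_vec (0\<^sub>v (d i))"
      then show "x $ k = 0\<^sub>v (d i) $ k" using f0[of "(i, 0, k)"] by (simp add: coords_def f_def)
    qed (use x in simp)
    moreover have "v j = 0\<^sub>v (od j i)" if j: "j \<in> nbrs \<Gamma> i" for j
    proof (rule eq_vecI)
      fix k assume "k < dim_vec (0\<^sub>v (od j i))"
      then show "v j $ k = 0\<^sub>v (od j i) $ k" using f0[of "(i, Suc j, k)"] j by (auto simp: coords_def f_def)
    qed (use v j in auto)
    ultimately show False using nz by blast
  qed
  then have "0 < (\<Sum>a\<in>coords i. (f a)\<^sup>2)"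
    using finite_coords by (metis (mono_tags, lifting) sum_pos2 zero_le_power2 zero_less_power2)
  then have "0 < \<epsilon> * (\<Sum>a\<in>coords i. (f a)\<^sup>2)" using \<epsilon> by simp
  moreover have "(\<Sum>j\<in>nbrs \<Gamma> i. pair_supply i (s j) (v j) (outp \<Gamma> i j x (v j)))
      = (\<Sum>j<n. if (i, j) \<in> U then s j (\<lambda>k. port i j k f) else 0)"
    unfolding sum_nbrs using pair_supply_port[OF _ s vf] by (intro sum.cong refl) (auto simp: xf)
  ultimately show "2 * (x \<bullet> (R *\<^sub>v xdot \<Gamma> i x v)) < (\<Sum>j\<in>nbrs \<Gamma> i. pair_supply i (s j) (v j) (outp \<Gamma> i j x (v j)))"
    using le[of f] unfolding xd by (simp add: xf)
qed

lemma decay_imp_supplies: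
  assumes wp: "well_posed \<Gamma>" and ac: "acyclic_network \<Gamma>"
    and P: "\<And>i. i < n \<Longrightarrow> P i \<in> carrier_mat (d i) (d i)"
    and neg: "\<And>x v w. states \<Gamma> x \<Longrightarrow> signals \<Gamma> x v w \<Longrightarrow> \<exists>i<n. x i \<noteq> 0\<^sub>v (d i) \<Longrightarrow>
      (\<Sum>i<n. 2 * (x i \<bullet> (P i *\<^sub>v xdot \<Gamma> i (x i) (v i)))) < 0"
  shows "\<exists>s. (\<forall>i j. (i, j) \<in> U \<longrightarrow> quad_form (ports i j) (s i j) \<and> (\<forall>p. s i j p + s j i p = 0)) \<and>
    (\<forall>i<n. strictly_dissipative \<Gamma> i (P i) (\<lambda>j. pair_supply i (s i j)))"
proof -
  define F where "F i f = 2 * (xs f i \<bullet> (P i *\<^sub>v xdot \<Gamma> i (xs f i) (vs f i)))" for i f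
  define I where "I = (\<Union>i<n. coords i)"
  \<comment> \<open>The penalty: all squared interconnection defects, summed over ordered pairs as
    in the induction over the forest.\<close>
  define R where "R f = (\<Sum>i<n. \<Sum>j<n. if (i, j) \<in> U then \<Sum>k\<in>ports i j. (port i j k f - port j i k f)\<^sup>2 else 0)" for f
  have I: "finite I" "\<And>i. i < n \<Longrightarrow> coords i \<subseteq> I" unfolding I_def using finite_coords by auto
  have F: "quad_form (coords i) (F i)" if "i < n" for i
    unfolding F_def by (rule quad_form_storage_rate[OF that P[OF that]])
  have FI: "quad_form I (\<lambda>f. \<Sum>i<n. F i f)"
    by (intro quad_form_sum quad_form_mono[OF F I(2) I(1)]) auto
  have RI: "quad_form I R"
  proof -
    have "quad_form I (\<lambda>f. if (i, j) \<in> U then \<Sum>k\<in>ports i j. (port i j k f - port j i k f)\<^sup>2 else 0)" for i j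
    proof (cases "(i, j) \<in> U")
      case True
      then have ji: "(j, i) \<in> U" using sym_U by (auto simp: sym_def)
      have "lin_form I (port i j k)" "lin_form I (port j i k)" if "k \<in> ports i j" for k
        using lin_form_mono[OF lin_form_port[OF True that] I(2) I(1)] U_lt[OF True]
          lin_form_mono[OF lin_form_port[OF ji, of k] I(2) I(1)] that ports_sym[of i j] by auto
      then have "quad_form I (\<lambda>f. \<Sum>k\<in>ports i j. (port i j k f - port j i k f)\<^sup>2)"
        by (intro quad_form_sum quad_form_power2 lin_form_diff)
      then show ?thesis using True by simp
    qed (simp add: quad_form_0)
    then show ?thesis unfolding R_def by (intro quad_form_sum)
  qed
  have R0: "R f \<ge> 0" for f unfolding R_def by (intro sum_nonneg) (auto intro!: sum_nonneg)
  have "(\<Sum>i<n. F i f) < 0" if "R f = 0" "\<exists>a\<in>I. f a \<noteq> 0" for f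
  proof -
    have *: "(\<Sum>j<n. if (i, j) \<in> U then \<Sum>k\<in>ports i j. (port i j k f - port j i k f)\<^sup>2 else 0) = 0" if "i < n" for i
      using \<open>R f = 0\<close> that unfolding R_def by (subst (asm) sum_nonneg_eq_0_iff) (auto intro!: sum_nonneg)
    have **: "(\<Sum>k\<in>ports i j. (port i j k f - port j i k f)\<^sup>2) = 0" if "(i, j) \<in> U" for i j
    proof -
      have "(if (i, j) \<in> U then \<Sum>k\<in>ports i j. (port i j k f - port j i k f)\<^sup>2 else 0) = 0"
        using *[of i, OF conjunct1[OF U_lt[OF that]]] U_lt[OF that] by (subst (asm) sum_nonneg_eq_0_iff) (auto intro!: sum_nonneg)
      then show ?thesis using that by simp
    qed
    have "port i j k f = port j i k f" if "(i, j) \<in> U" "k \<in> ports i j" for i j k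
      using **[OF that(1)] that(2) finite_ports by (subst (asm) sum_nonneg_eq_0_iff) auto
    then have sg: "signals \<Gamma> (xs f) (vs f) (\<lambda>i j. outp \<Gamma> i j (xs f i) (vs f i j))" by (rule signals_of_ports)
    obtain i a where "i < n" "a \<in> coords i" "f a \<noteq> 0" using \<open>\<exists>a\<in>I. f a \<noteq> 0\<close> unfolding I_def by auto
    then have "\<exists>i<n. xs f i \<noteq> 0\<^sub>v (d i)" by (rule signals_nonzero_state[OF wp sg])
    then show ?thesis unfolding F_def by (intro neg[OF _ sg]) (simp add: states_def)
  qed
  from finsler_strict[OF I(1) FI RI R0 this] obtain c \<epsilon> where ce: "0 < c" "0 < \<epsilon>"
    "\<And>f. \<exists>a\<in>I. f a \<noteq> 0 \<Longrightarrow> (\<Sum>i<n. F i f) + \<epsilon> * (\<Sum>a\<in>I. (f a)\<^sup>2) - c * R f < 0" by blast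
  \<comment> \<open>Different systems have disjoint coordinates, so the margin can be divided among
    them.\<close>
  define F' where "F' i f = F i f + \<epsilon> * (\<Sum>a\<in>coords i. (f a)\<^sup>2)" for i f
  have sumF': "(\<Sum>i<n. F' i f) = (\<Sum>i<n. F i f) + \<epsilon> * (\<Sum>a\<in>I. (f a)\<^sup>2)" for f
    unfolding F'_def I_def using coords_disjoint finite_coords
    by (subst sum.UNION_disjoint) (auto simp: sum.distrib sum_distrib_left)
  have "\<exists>s. (\<forall>i\<in>{..<n}. \<forall>j\<in>{..<n}. (i, j) \<in> U \<longrightarrow> quad_form (ports i j) (s i j) \<and> (\<forall>p. s i j p + s j i p = 0)) \<and>
    (\<forall>i\<in>{..<n}. \<forall>f. F' i f \<le> (\<Sum>j\<in>{..<n}. if (i, j) \<in> U then s i j (\<lambda>k. port i j k f) else 0))"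
  proof (rule forest_supplies[OF sym_U irrefl_U ac[unfolded acyclic_network_def] ports_sym finite_ports])
    show "quad_form (coords i) (F' i)" if "i \<in> {..<n}" for i
      unfolding F'_def using that by (intro quad_form_add F quad_form_scale quad_form_sum_squares finite_coords) simp
    show "(\<Sum>i<n. F' i f) - c * (\<Sum>i<n. \<Sum>j<n. if (i, j) \<in> U then \<Sum>k\<in>ports i j. (port i j k f - port j i k f)\<^sup>2 else 0) < 0"
      if "\<exists>i\<in>{..<n}. \<exists>a\<in>coords i. f a \<noteq> 0" for f
      using ce(3)[of f] that unfolding sumF' R_def[symmetric] I_def by blast
  qed (use finite_coords coords_disjoint lin_form_port in auto)
  then obtain s where s: "\<And>i j. (i, j) \<in> U \<Longrightarrow> quad_form (ports i j) (s i j) \<and> (\<forall>p. s i j p + s j i p = 0)"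
    "\<And>i f. i < n \<Longrightarrow> F' i f \<le> (\<Sum>j<n. if (i, j) \<in> U then s i j (\<lambda>k. port i j k f) else 0)"
    using U_lt by blast
  have "strictly_dissipative \<Gamma> i (P i) (\<lambda>j. pair_supply i (s i j))" if "i < n" for i
    using s(2)[OF that] s(1) unfolding F'_def F_def
    by (intro local_supplies_imp_dissipative[OF that ce(2)]) auto
  then show ?thesis using s(1) by blast
qed

text \<open>Over the network the supplies cancel in pairs. Strict dissipativity is silent about a
  system whose state and inputs vanish; there both sides are 0, and the sum is strict because of a
  system with nonzero state.\<close>

lemma supplies_imp_decay:
  assumes q: "\<And>i j. (i, j) \<in> U \<Longrightarrow> quadratic_function (od j i) (od i j) (s i j)"
    and diss: "\<And>i. i < n \<Longrightarrow> strictly_dissipative \<Gamma> i (P i) (s i)"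
    and P: "\<And>i. i < n \<Longrightarrow> P i \<in> carrier_mat (d i) (d i)"
    and cancel: "\<And>i j v w. (i, j) \<in> U \<Longrightarrow> v \<in> carrier_vec (od j i) \<Longrightarrow> w \<in> carrier_vec (od i j) \<Longrightarrow>
      s i j v w + s j i w v = 0"
    and x: "states \<Gamma> x" "signals \<Gamma> x v w" "\<exists>i<n. x i \<noteq> 0\<^sub>v (d i)"
  shows "(\<Sum>i<n. 2 * (x i \<bullet> (P i *\<^sub>v xdot \<Gamma> i (x i) (v i)))) < 0"
proof -
  note sg = x(2)[unfolded signals_iff] and c = xdot_carrier_signals[OF x(1,2)]
  let ?F = "\<lambda>i. 2 * (x i \<bullet> (P i *\<^sub>v xdot \<Gamma> i (x i) (v i)))"
  let ?S = "\<lambda>i. \<Sum>j\<in>nbrs \<Gamma> i. s i j (v i j) (outp \<Gamma> i j (x i) (v i j))"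
  have lt: "?F i < ?S i" if "i < n" "x i \<noteq> 0\<^sub>v (d i) \<or> (\<exists>j\<in>nbrs \<Gamma> i. v i j \<noteq> 0\<^sub>v (od j i))" for i
    using diss[OF that(1)] that(2) c(1,2)[OF that(1)] unfolding strictly_dissipative_def by (simp add: nbrs_iff)
  have le: "?F i \<le> ?S i" if i: "i < n" for i
  proof (cases "x i \<noteq> 0\<^sub>v (d i) \<or> (\<exists>j\<in>nbrs \<Gamma> i. v i j \<noteq> 0\<^sub>v (od j i))")
    case False
    have "?F i = 0" using False P[OF i] c(3)[OF i] by (simp add: mult_mat_vec_carrier[of _ "d i" "d i"])
    moreover have "?S i = 0"
      using False by (intro sum.neutral) (auto simp: nbrs_iff outp_zero quadratic_function_zero[OF q])
    ultimately show ?thesis by simp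
  qed (use lt[OF i] in simp)
  have "(\<Sum>i<n. ?F i) < (\<Sum>i<n. ?S i)"
    by (rule sum_strict_mono_ex1) (use le lt x(3) in auto)
  also have "(\<Sum>i<n. ?S i) = 0"
  proof -
    define T where "T i j = (if (i, j) \<in> U then s i j (v i j) (w i j) else 0)" for i j
    have "T i j + T j i = 0" for i j
    proof (cases "(i, j) \<in> U")
      case True
      then have ji: "(j, i) \<in> U" using sym_U by (auto simp: sym_def)
      \<comment> \<open>On a directed edge this is the interconnection constraint; in an absent
        direction both signals have dimension 0.\<close>
      have eq: "v b a = w a b" if "(a, b) \<in> U" for a b
      proof (cases "(a, b) \<in> edges \<Gamma>")
        case False
        then have "od a b = 0" using BCD_carrier(4)[OF that] by simp
        moreover have "(b, a) \<in> U" using that sym_U by (auto simp: sym_def)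
        ultimately have "v b a \<in> carrier_vec 0" "w a b \<in> carrier_vec 0" using sg that by metis+
        then show ?thesis by (intro eq_vecI) auto
      qed (use sg in blast)
      have "v j i = w i j" "w j i = v i j" using eq[OF True] eq[OF ji] by auto
      moreover have "v i j \<in> carrier_vec (od j i)" "w i j \<in> carrier_vec (od i j)" using sg True by blast+
      ultimately show ?thesis using cancel[OF True] True ji by (simp add: T_def)
    next
      case False
      then have "(j, i) \<notin> U" using sym_U by (auto simp: sym_def)
      then show ?thesis using False by (simp add: T_def)
    qed
    then have "(\<Sum>i<n. \<Sum>j<n. T i j) + (\<Sum>i<n. \<Sum>j<n. T j i) = 0"
      unfolding sum.distrib[symmetric] by simp
    moreover have "(\<Sum>i<n. \<Sum>j<n. T j i) = (\<Sum>i<n. \<Sum>j<n. T i j)" by (rule sum.swap)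
    moreover have "?S i = (\<Sum>j<n. T i j)" for i
      unfolding sum_nbrs T_def using sg by (intro sum.cong refl) auto
    ultimately show ?thesis by simp
  qed
  finally show ?thesis .
qed

lemma pair_supply_quadratic:
  assumes "(i, j) \<in> U" "quad_form (ports i j) s"
  shows "quadratic_function (od j i) (od i j) (pair_supply i s)"
  unfolding pair_supply_def[abs_def] using assms irrefl_U
  by (intro quad_form_imp_quadratic_function[of i j]) (auto simp: irrefl_def ports_def)

text \<open>On the ports of the edge, being tagged \<open>i\<close> is the same as not being tagged
  \<open>j\<close>, so both ends evaluate their forms at the same point.\<close>

lemma pair_supply_cancel:
  assumes "(i, j) \<in> U" "quad_form (ports i j) s" "\<And>p. s p + s' p = 0"
  shows "pair_supply i s v w + pair_supply j s' w v = 0"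
proof -
  have ij: "i \<noteq> j" using assms(1) irrefl_U by (auto simp: irrefl_def)
  have "pair_supply i s v w = s (\<lambda>(m, r). if m = j then w $ r else v $ r)"
    unfolding pair_supply_def by (rule quad_form_cong[OF assms(2)]) (use ij in \<open>auto simp: ports_def\<close>)
  then show ?thesis using assms(3) by (simp add: pair_supply_def)
qed

end

theorem theorem4p1:
  fixes \<Gamma> :: network and P :: "nat \<Rightarrow> real mat"
  assumes "is_network \<Gamma>"
    and "acyclic_network \<Gamma>"
    and "(\<forall>i < nsys \<Gamma>. \<forall>j \<in> nbrs \<Gamma> i. full_row_rank (Cmat \<Gamma> i j)) \<or>
         (\<forall>(i, j) \<in> edges \<Gamma>. Dmat \<Gamma> i j = 0\<^sub>m (odim \<Gamma> i j) (odim \<Gamma> j i))"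
    and "well_posed \<Gamma>"
    and "\<forall>i < nsys \<Gamma>. P i \<in> carrier_mat (sdim \<Gamma> i) (sdim \<Gamma> i) \<and> pos_def_mat (P i)"
  shows "additive_quadratic_lyapunov \<Gamma> P \<longleftrightarrow>
    (\<exists>s :: nat \<Rightarrow> nat \<Rightarrow> real vec \<Rightarrow> real vec \<Rightarrow> real.
       (\<forall>i < nsys \<Gamma>. \<forall>j \<in> nbrs \<Gamma> i. quadratic_function (odim \<Gamma> j i) (odim \<Gamma> i j) (s i j)) \<and>
       (\<forall>i < nsys \<Gamma>. strictly_dissipative \<Gamma> i (P i) (s i)) \<and>
       (\<forall>(i, j) \<in> uedges \<Gamma>.
          \<forall>vij \<in> carrier_vec (odim \<Gamma> j i). \<forall>wij \<in> carrier_vec (odim \<Gamma> i j).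
          \<forall>vji \<in> carrier_vec (odim \<Gamma> i j). \<forall>wji \<in> carrier_vec (odim \<Gamma> j i).
            vij = wji \<longrightarrow> vji = wij \<longrightarrow> s i j vij wij + s j i vji wji = 0))"
    (is "?L \<longleftrightarrow> (\<exists>s. ?Q s \<and> ?D s \<and> ?C s)")
proof -
  interpret dynamical_network \<Gamma> by unfold_locales (rule assms(1))
  have P: "P i \<in> carrier_mat (d i) (d i)" "transpose_mat (P i) = P i" if "i < n" for i
    using assms(5) that by (auto simp: pos_def_mat_def)
  have lyap: "?L \<longleftrightarrow> (\<forall>x v w. states \<Gamma> x \<longrightarrow> signals \<Gamma> x v w \<longrightarrow>
      (\<exists>i<n. x i \<noteq> 0\<^sub>v (d i)) \<longrightarrow> (\<Sum>i<n. 2 * (x i \<bullet> (P i *\<^sub>v xdot \<Gamma> i (x i) (v i)))) < 0)"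
    by (rule additive_quadratic_lyapunov_iff[OF assms(4)]; rule P)
  show ?thesis
  proof
    assume ?L
    have "\<exists>s. (\<forall>i j. (i, j) \<in> U \<longrightarrow> quad_form (ports i j) (s i j) \<and> (\<forall>p. s i j p + s j i p = 0)) \<and>
      (\<forall>i<n. strictly_dissipative \<Gamma> i (P i) (\<lambda>j. pair_supply i (s i j)))"
      by (rule decay_imp_supplies[OF assms(4,2)], erule P) (use \<open>?L\<close> lyap in blast)
    then obtain s where s: "\<And>i j. (i, j) \<in> U \<Longrightarrow> quad_form (ports i j) (s i j) \<and> (\<forall>p. s i j p + s j i p = 0)"
      "\<And>i. i < n \<Longrightarrow> strictly_dissipative \<Gamma> i (P i) (\<lambda>j. pair_supply i (s i j))"
      by blast
    let ?s = "\<lambda>i j. pair_supply i (s i j)"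
    have "?Q ?s" using s(1) by (auto simp: nbrs_iff intro: pair_supply_quadratic)
    moreover have "?D ?s" using s(2) by simp
    moreover have "?C ?s" using s(1) pair_supply_cancel by fastforce
    ultimately show "\<exists>s. ?Q s \<and> ?D s \<and> ?C s" by (intro exI[of _ ?s] conjI)
  next
    assume "\<exists>s. ?Q s \<and> ?D s \<and> ?C s"
    then obtain s where s: "?Q s" "?D s" "?C s" by blast
    have q: "quadratic_function (od j i) (od i j) (s i j)" if "(i, j) \<in> U" for i j
      using s(1) that U_lt[OF that] by (simp add: nbrs_iff)
    have c: "s i j v w + s j i w v = 0"
      if "(i, j) \<in> U" "v \<in> carrier_vec (od j i)" "w \<in> carrier_vec (od i j)" for i j v w
      using s(3) that by blast
    show ?L unfolding lyap
    proof (intro allI impI)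
      fix x v w assume x: "states \<Gamma> x" "signals \<Gamma> x v w" "\<exists>i<n. x i \<noteq> 0\<^sub>v (d i)"
      show "(\<Sum>i<n. 2 * (x i \<bullet> (P i *\<^sub>v xdot \<Gamma> i (x i) (v i)))) < 0"
        by (rule supplies_imp_decay[OF _ _ _ _ x]) (use q s(2) P(1) c in blast)+
    qed
  qed
qed

end
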